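(* Let $S$ be a cut-free net atomically testable by a sequent $A_1,\dots,A_n$. If $S$ is not correct (i.e. $S$ represents no proof of $\mathsf{MLL}^\maltese$), then there exist nets $T_1\in\mathsf{tests}(A_1),\dots,T_n\in\mathsf{tests}(A_n)$ such that the normal form $S_0$ of $S::(T_1\parallel\cdots\parallel T_n)$ is not correct; more precisely, either $S_0$ is a sum of $k\ge 2$ daimon links without outputs ($S_0=\sum_{1\le i\le k}\maltese_0$), or $S_0$ contains a cyclic cut, i.e. a cut link whose two inputs are outputs of the same daimon link.
   Context: **Nets.** Fix a countable set of positions. A hypergraph has a finite set $V$ of positions and a finite set $E$ of labelled links; each link has a source and a target, which are finite sequences of pairwise distinct positions, the source and the target being disjoint. The only links used are: tensor links $\langle p_1,p_2\rhd_\otimes p\rangle$ and par links $\langle p_1,p_2\rhd_\wp p\rangle$ (two inputs, one output), cut links $\langle p_1,p_2\rhd_{\mathsf{cut}}\rangle$ (two inputs, no output), and daimon links $\langle\rhd_\maltese p_1,\dots,p_n\rangle$, $n\ge 0$ (no input). ($\wp$ denotes the par connective.) The sum $H_1+H_2$ takes the union of positions and the disjoint union of links. A conclusion is a position that is in the source of no link. A (multiplicative) net $S$ is a finite sum of such links in which every position is in the target of exactly one link and in the source of at most one link, together with a total order on its conclusions; $S(i)$ is the $i$-th conclusion and $\#S$ the number of conclusions. A net is cut-free if it has no cut link. Nets are considered up to isomorphism. $S\parallel T$ is the disjoint union (after renaming positions), with the conclusions of $S$ ordered before those of $T$. $\maltese_n$ is the net made of one daimon link with $n$ outputs. Initial positions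 are the outputs of daimon links. **Cut elimination.** The interactions $S::(T_1\parallel\cdots\parallel T_n)$ considered here reduce to their normal form using only the homogeneous rules, closed under sum with a context and insensitive to the order of the inputs of cut links: (i) $\langle p_1,p_2\rhd_\wp p\rangle+\langle p,q\rhd_{\mathsf{cut}}\rangle+\langle q_1,q_2\rhd_\otimes q\rangle\to\langle p_1,q_1\rhd_{\mathsf{cut}}\rangle+\langle p_2,q_2\rhd_{\mathsf{cut}}\rangle$; (ii) for two distinct daimon links, $\langle\rhd_\maltese\bar p\rangle+\langle p_i,q_j\rhd_{\mathsf{cut}}\rangle+\langle\rhd_\maltese\bar q\rangle\to\langle\rhd_\maltese\bar p\setminus p_i,\bar q\setminus q_j\rangle$. (The full cut elimination relation also has rules for cuts between a daimon link and a tensor or par link, but no such cut occurs when reducing these interactions.) Homogeneous cut elimination is confluent and strongly normalising (up to the order of the outputs of daimon links). **Interaction.** For nets $S,T$ with $k=\min(\#S,\#T)$, $S::T$ is $S+T+\sum_{1\le i\le k}\langle S(i),T(i)\rhd_{\mathsf{cut}}\rangle$ ($S,T$ made disjoint), the remaining conclusions keeping their order. **Logic.** Propositional variables form a countable set with an involution $X\mapsto X^\bot$. Formulas: $A,B::=X\mid A\wp B\mid A\otimes B$, with $(A\wp B)^\bot=A^\bot\otimes B^\bot$, $(A\otimes B)^\bot=A^\bot\wp B^\bot$. Sequents are finite sequences of formulas. $\mathsf{MLL}^\maltese$ proofs are trees built with the rules: ($\maltese$) infer any $\Gamma$ with no premise; ($\wp$) from $\Gamma,A,B$ infer $\Gamma,A\wp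 B$; ($\otimes$) from $\Gamma,A$ and $\Delta,B$ infer $\Gamma,\Delta,A\otimes B$; (cut) from $\Gamma,A$ and $\Delta,A^\bot$ infer $\Gamma,\Delta$; (ex) exchange of two consecutive formulas. A net $S$ represents a proof $\pi$ of $A_1,\dots,A_n$ (the $i$-th conclusion of $S$ corresponding to $A_i$), inductively: a $\maltese$-rule is represented by a single daimon link $\langle\rhd_\maltese p_1,\dots,p_n\rangle$ with conclusions ordered $p_1,\dots,p_n$; a $\wp$-rule by adding a par link with fresh output to the conclusions for $A,B$ of a net representing the premise; a $\otimes$-rule (resp. cut-rule) by the disjoint sum of nets representing the premises plus a tensor link with fresh output (resp. a cut link) on the conclusions for the two active formulas; exchange by exchanging the two conclusions in the order. A net is correct if it represents some $\mathsf{MLL}^\maltese$ proof. **Atomic testability.** A formula labelling of a cut-free net $S$ is a function $\tau$ from its positions to formulas such that $\tau(p)=\tau(p_1)\wp\tau(p_2)$ for each par link $\langle p_1,p_2\rhd_\wp p\rangle$ and $\tau(p)=\tau(p_1)\otimes\tau(p_2)$ for each tensor link $\langle p_1,p_2\rhd_\otimes p\rangle$ of $S$. It is atomic if every output of every daimon link is labelled by a propositional variable. A cut-free net $S$ with $n$ conclusions is atomically testable by $A_1,\dots,A_n$ if it has an atomic formula labelling $\tau$ with $\tau(S(i))=A_i$ for all $i$. **Natural partitions.** In such a net $S$ there is a binary tree of connective links above each conclusion; each initial position $p$ is determined by the index $i$ of the conclusion $S(i)$ below it and its address, the left/right word leading from $S(i)$ up to $p$. Order the $n$ initial positions lexicographically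 by (index, address), left before right. For a partition $P$ of the initial positions of $S$, $\mathbf{Nat}_S(P)$ is the corresponding partition of $\{1,\dots,n\}$. $\mathsf P_\maltese(S)$ is the partition $\{\mathrm t(d)\mid d\text{ a daimon link of }S\}$, $\mathrm t(d)$ being the set of outputs of $d$. **Switchings.** For a par link $\langle p_1,p_2\rhd_\wp p\rangle$ of a net, a left (resp. right) switching step deletes this link and replaces $p_1$ (resp. $p_2$) by $p$ in the target of the link having it as an output; $p_2$ (resp. $p_1$) becomes a new (last) conclusion. A switching $\sigma S$ of $S$ is a normal form of $S$ for these steps (so it has no par link). Its initial positions are identified with those of $S$ via the replacements. For cut-free $S$, $\uparrow^i\sigma S$ is the partition of the initial positions having one class for each conclusion $q$ of $\sigma S$, namely the set of initial positions above $q$ in $\sigma S$ (those from which $q$ is reached by going repeatedly from an input to an output of a link). **Tests.** A cut-free net $T$ is a test of a formula $A$ if $T$ is atomically testable by $A^\bot$ and there exist a (cut-free) net $S$ atomically testable by $A$ and a switching $\sigma S$ of $S$ such that $\mathbf{Nat}_T(\mathsf P_\maltese(T))=\mathbf{Nat}_S(\uparrow^i\sigma S)$. $\mathsf{tests}(A)$ is the set of tests of $A$.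
   Formalization: A net is taken to be a sum of at least one link; the empty net (n = 0) is excluded, since it represents no proof yet its interaction with nothing is empty, so it is neither a sum of k ≥ 2 daimons nor contains a cyclic cut. *)

theory Defs
  imports "HOL-Library.Multiset" "HOL-Library.Countable"
begin

section \<open>Nets\<close>

datatype 'p link =
    Tensor 'p 'p 'p   \<comment> \<open>\<open>Tensor p1 p2 p\<close>: inputs \<open>p1\<close>, \<open>p2\<close>, output \<open>p\<close>\<close>
  | Par 'p 'p 'p
  | Cut 'p 'p
  | Daimon "'p list"

primrec inputs :: "'p link \<Rightarrow> 'p list" where
  "inputs (Tensor p1 p2 p) = [p1, p2]"
| "inputs (Par p1 p2 p) = [p1, p2]"
| "inputs (Cut p1 p2) = [p1, p2]"
| "inputs (Daimon ps) = []"

primrec outputs :: "'p link \<Rightarrow> 'p list" where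
  "outputs (Tensor p1 p2 p) = [p]"
| "outputs (Par p1 p2 p) = [p]"
| "outputs (Cut p1 p2) = []"
| "outputs (Daimon ps) = ps"

definition wf_link :: "'p link \<Rightarrow> bool" where
  "wf_link l \<longleftrightarrow> distinct (inputs l @ outputs l)"

text \<open>
  The labels of the links only serve to distinguish several occurrences of the same link (which
  is possible in a net for \<open>Daimon []\<close>), so the links form a multiset, and the disjoint union
  of links is the sum of multisets. The conclusions are listed in their order; \<open>S(i)\<close>, counted
  from 1, is \<open>conclusions S ! (i - 1)\<close>. The type does not impose the conditions on nets,
  see \<open>is_net\<close>.
\<close>

datatype 'p net = Net (links: "'p link multiset") (conclusions: "'p list")

definition positions :: "'p net \<Rightarrow> 'p set" where
  "positions S = (\<Union>l \<in> set_mset (links S). set (inputs l) \<union> set (outputs l))"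

text \<open>
  A net is a sum of at least one link: the empty hypergraph is not a net. Daimons without
  outputs are allowed, so a net may have no position and no conclusion.
\<close>

definition is_net :: "'p net \<Rightarrow> bool" where
  "is_net S \<longleftrightarrow>
     links S \<noteq> {#} \<and>
     (\<forall>l \<in># links S. wf_link l) \<and>
     (\<forall>p \<in> positions S. size {#l \<in># links S. p \<in> set (outputs l)#} = 1 \<and>
                        size {#l \<in># links S. p \<in> set (inputs l)#} \<le> 1) \<and>
     distinct (conclusions S) \<and>
     set (conclusions S) = {p \<in> positions S. \<forall>l \<in># links S. p \<notin> set (inputs l)}"

definition cut_free :: "'p net \<Rightarrow> bool" where
  "cut_free S \<longleftrightarrow> (\<forall>p q. Cut p q \<notin># links S)"

definition initial_positions :: "'p net \<Rightarrow> 'p set" where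
  "initial_positions S = {p. \<exists>ps. Daimon ps \<in># links S \<and> p \<in> set ps}"

text \<open>
  Nets are considered up to renaming of positions, and every notion below is invariant under it.
  Operations that need disjoint nets rename the positions of the left net to even numbers and
  those of the right net to odd numbers.
\<close>

abbreviation rename_left :: "nat net \<Rightarrow> nat net" where
  "rename_left \<equiv> map_net (\<lambda>p. 2 * p)"

abbreviation rename_right :: "nat net \<Rightarrow> nat net" where
  "rename_right \<equiv> map_net (\<lambda>p. 2 * p + 1)"

definition parallel :: "nat net \<Rightarrow> nat net \<Rightarrow> nat net" where
  "parallel S T =
     Net (links (rename_left S) + links (rename_right T))
         (conclusions (rename_left S) @ conclusions (rename_right T))"

definition parallel_list :: "nat net list \<Rightarrow> nat net" where
  "parallel_list Ts = foldr parallel Ts (Net {#} [])"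

definition interaction :: "nat net \<Rightarrow> nat net \<Rightarrow> nat net" where
  "interaction S T =
     (let cs = conclusions (rename_left S);
          ds = conclusions (rename_right T);
          k = min (length cs) (length ds)
      in Net (links (rename_left S) + links (rename_right T)
                + mset (map2 Cut (take k cs) (take k ds)))
             (drop k cs @ drop k ds))"

section \<open>Homogeneous cut elimination\<close>

inductive cut_step :: "'p net \<Rightarrow> 'p net \<Rightarrow> bool" where
  multiplicative:
    "c \<in> {Cut p q, Cut q p} \<Longrightarrow>
     cut_step (Net ({#Par p1 p2 p, c, Tensor q1 q2 q#} + L) C)
              (Net ({#Cut p1 q1, Cut p2 q2#} + L) C)"
| daimon:
    "c \<in> {Cut p q, Cut q p} \<Longrightarrow>
     cut_step (Net ({#Daimon (ps @ p # ps'), c, Daimon (qs @ q # qs')#} + L) C)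
              (Net ({#Daimon (ps @ ps' @ qs @ qs')#} + L) C)"

definition normal_form_of :: "'p net \<Rightarrow> 'p net \<Rightarrow> bool" where
  "normal_form_of S S0 \<longleftrightarrow> cut_step\<^sup>*\<^sup>* S S0 \<and> (\<nexists>S'. cut_step S0 S')"

definition has_cyclic_cut :: "'p net \<Rightarrow> bool" where
  "has_cyclic_cut S \<longleftrightarrow>
     (\<exists>p q ps. Cut p q \<in># links S \<and> Daimon ps \<in># links S \<and> p \<in> set ps \<and> q \<in> set ps)"

section \<open>Formulas, proofs and correct nets\<close>

datatype 'x formula =
    Var 'x
  | FPar "'x formula" "'x formula"
  | FTensor "'x formula" "'x formula"

text \<open>\<open>perp\<close> is the involution on propositional variables.\<close>

primrec dual :: "('x \<Rightarrow> 'x) \<Rightarrow> 'x formula \<Rightarrow> 'x formula" where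
  "dual perp (Var X) = Var (perp X)"
| "dual perp (FPar A B) = FTensor (dual perp A) (dual perp B)"
| "dual perp (FTensor A B) = FPar (dual perp A) (dual perp B)"

text \<open>
  \<open>ExR i\<close> exchanges the formulas with (zero-based) indices \<open>i\<close> and \<open>i + 1\<close>. The other rules
  act on the last formulas of their premises, so they determine their active formulas.
\<close>

datatype 'x mll_proof =
    DaimonR "'x formula list"
  | ParR "'x mll_proof"
  | TensorR "'x mll_proof" "'x mll_proof"
  | CutR "'x mll_proof" "'x mll_proof"
  | ExR nat "'x mll_proof"

inductive proves :: "('x \<Rightarrow> 'x) \<Rightarrow> 'x mll_proof \<Rightarrow> 'x formula list \<Rightarrow> bool"
  for perp :: "'x \<Rightarrow> 'x" where
  daimon: "proves perp (DaimonR \<Gamma>) \<Gamma>"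
| par: "proves perp \<pi> (\<Gamma> @ [A, B]) \<Longrightarrow> proves perp (ParR \<pi>) (\<Gamma> @ [FPar A B])"
| tensor:
    "proves perp \<pi> (\<Gamma> @ [A]) \<Longrightarrow> proves perp \<rho> (\<Delta> @ [B]) \<Longrightarrow>
     proves perp (TensorR \<pi> \<rho>) (\<Gamma> @ \<Delta> @ [FTensor A B])"
| cut:
    "proves perp \<pi> (\<Gamma> @ [A]) \<Longrightarrow> proves perp \<rho> (\<Delta> @ [dual perp A]) \<Longrightarrow>
     proves perp (CutR \<pi> \<rho>) (\<Gamma> @ \<Delta>)"
| exchange:
    "proves perp \<pi> (\<Gamma> @ [A, B] @ \<Delta>) \<Longrightarrow>
     proves perp (ExR (length \<Gamma>) \<pi>) (\<Gamma> @ [B, A] @ \<Delta>)"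

inductive represents :: "'p net \<Rightarrow> 'x mll_proof \<Rightarrow> bool" where
  daimon:
    "distinct ps \<Longrightarrow> length ps = length \<Gamma> \<Longrightarrow> represents (Net {#Daimon ps#} ps) (DaimonR \<Gamma>)"
| par:
    "represents (Net L (C @ [p1, p2])) \<pi> \<Longrightarrow> p \<notin> positions (Net L (C @ [p1, p2])) \<Longrightarrow>
     represents (Net (add_mset (Par p1 p2 p) L) (C @ [p])) (ParR \<pi>)"
| tensor:
    "represents (Net L (C @ [p1])) \<pi> \<Longrightarrow> represents (Net M (D @ [p2])) \<rho> \<Longrightarrow>
     positions (Net L (C @ [p1])) \<inter> positions (Net M (D @ [p2])) = {} \<Longrightarrow>
     p \<notin> positions (Net L (C @ [p1])) \<union> positions (Net M (D @ [p2])) \<Longrightarrow>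
     represents (Net (add_mset (Tensor p1 p2 p) (L + M)) (C @ D @ [p])) (TensorR \<pi> \<rho>)"
| cut:
    "represents (Net L (C @ [p1])) \<pi> \<Longrightarrow> represents (Net M (D @ [p2])) \<rho> \<Longrightarrow>
     positions (Net L (C @ [p1])) \<inter> positions (Net M (D @ [p2])) = {} \<Longrightarrow>
     c \<in> {Cut p1 p2, Cut p2 p1} \<Longrightarrow>
     represents (Net (add_mset c (L + M)) (C @ D)) (CutR \<pi> \<rho>)"
| exchange:
    "represents (Net L (C @ [p, q] @ D)) \<pi> \<Longrightarrow>
     represents (Net L (C @ [q, p] @ D)) (ExR (length C) \<pi>)"

definition correct :: "('x \<Rightarrow> 'x) \<Rightarrow> 'p net \<Rightarrow> bool" where
  "correct perp S \<longleftrightarrow> (\<exists>\<pi> \<Gamma>. proves perp \<pi> \<Gamma> \<and> represents S \<pi>)"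

section \<open>Atomic testability\<close>

definition formula_labelling :: "'p net \<Rightarrow> ('p \<Rightarrow> 'x formula) \<Rightarrow> bool" where
  "formula_labelling S \<tau> \<longleftrightarrow>
     (\<forall>p1 p2 p. Par p1 p2 p \<in># links S \<longrightarrow> \<tau> p = FPar (\<tau> p1) (\<tau> p2)) \<and>
     (\<forall>p1 p2 p. Tensor p1 p2 p \<in># links S \<longrightarrow> \<tau> p = FTensor (\<tau> p1) (\<tau> p2))"

definition atomic_labelling :: "'p net \<Rightarrow> ('p \<Rightarrow> 'x formula) \<Rightarrow> bool" where
  "atomic_labelling S \<tau> \<longleftrightarrow> (\<forall>p \<in> initial_positions S. \<exists>X. \<tau> p = Var X)"

definition atomically_testable :: "'p net \<Rightarrow> 'x formula list \<Rightarrow> bool" where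
  "atomically_testable S As \<longleftrightarrow>
     (\<exists>\<tau>. formula_labelling S \<tau> \<and> atomic_labelling S \<tau> \<and> map \<tau> (conclusions S) = As)"

section \<open>Natural partitions\<close>

text \<open>
  \<open>located S i w p\<close>: the position \<open>p\<close> is reached by following the word \<open>w\<close> upwards from the
  conclusion with (zero-based) index \<open>i\<close>, where \<open>False\<close> stands for left and \<open>True\<close> for right.
\<close>

inductive located :: "'p net \<Rightarrow> nat \<Rightarrow> bool list \<Rightarrow> 'p \<Rightarrow> bool" for S :: "'p net" where
  root: "i < length (conclusions S) \<Longrightarrow> located S i [] (conclusions S ! i)"
| left:
    "located S i w p \<Longrightarrow> Par p1 p2 p \<in># links S \<or> Tensor p1 p2 p \<in># links S \<Longrightarrow>
     located S i (w @ [False]) p1"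
| right:
    "located S i w p \<Longrightarrow> Par p1 p2 p \<in># links S \<or> Tensor p1 p2 p \<in># links S \<Longrightarrow>
     located S i (w @ [True]) p2"

definition before :: "'p net \<Rightarrow> 'p \<Rightarrow> 'p \<Rightarrow> bool" where
  "before S p q \<longleftrightarrow>
     (\<exists>i w j v. located S i w p \<and> located S j v q \<and>
        (i < j \<or> i = j \<and> (w, v) \<in> lexord {(False, True)}))"

definition natural_index :: "'p net \<Rightarrow> 'p \<Rightarrow> nat" where
  "natural_index S p = card {q \<in> initial_positions S. before S q p} + 1"

definition natural_partition :: "'p net \<Rightarrow> 'p set set \<Rightarrow> nat set set" where
  "natural_partition S P = (\<lambda>c. natural_index S ` c) ` P"

definition daimon_partition :: "'p net \<Rightarrow> 'p set set" where
  "daimon_partition S = {set ps | ps. Daimon ps \<in># links S}"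

section \<open>Switchings\<close>

primrec map_outputs :: "('p \<Rightarrow> 'p) \<Rightarrow> 'p link \<Rightarrow> 'p link" where
  "map_outputs f (Tensor p1 p2 p) = Tensor p1 p2 (f p)"
| "map_outputs f (Par p1 p2 p) = Par p1 p2 (f p)"
| "map_outputs f (Cut p1 p2) = Cut p1 p2"
| "map_outputs f (Daimon ps) = Daimon (map f ps)"

text \<open>
  The second component of a state sends each initial position of the original net to the position
  that has replaced it in the first component.
\<close>

inductive switching_step :: "'p net \<times> ('p \<Rightarrow> 'p) \<Rightarrow> 'p net \<times> ('p \<Rightarrow> 'p) \<Rightarrow> bool" where
  left:
    "r = id(p1 := p) \<Longrightarrow>
     switching_step (Net (add_mset (Par p1 p2 p) L) C, \<iota>)
                    (Net (image_mset (map_outputs r) L) (C @ [p2]), r \<circ> \<iota>)"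
| right:
    "r = id(p2 := p) \<Longrightarrow>
     switching_step (Net (add_mset (Par p1 p2 p) L) C, \<iota>)
                    (Net (image_mset (map_outputs r) L) (C @ [p1]), r \<circ> \<iota>)"

definition switching_of :: "'p net \<Rightarrow> 'p net \<times> ('p \<Rightarrow> 'p) \<Rightarrow> bool" where
  "switching_of S \<sigma> \<longleftrightarrow> switching_step\<^sup>*\<^sup>* (S, id) \<sigma> \<and> (\<nexists>\<sigma>'. switching_step \<sigma> \<sigma>')"

definition descends :: "'p net \<Rightarrow> 'p \<Rightarrow> 'p \<Rightarrow> bool" where
  "descends H p q \<longleftrightarrow> (\<exists>l \<in># links H. p \<in> set (inputs l) \<and> q \<in> set (outputs l))"

definition switching_partition :: "'p net \<Rightarrow> 'p net \<times> ('p \<Rightarrow> 'p) \<Rightarrow> 'p set set" where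
  "switching_partition S \<sigma> =
     {{p \<in> initial_positions S. (descends (fst \<sigma>))\<^sup>*\<^sup>* (snd \<sigma> p) q} | q.
        q \<in> set (conclusions (fst \<sigma>))}"

section \<open>Tests\<close>

definition tests :: "('x \<Rightarrow> 'x) \<Rightarrow> 'x formula \<Rightarrow> nat net set" where
  "tests perp A =
     {T. is_net T \<and> cut_free T \<and> atomically_testable T [dual perp A] \<and>
         (\<exists>(S :: nat net) \<sigma>. is_net S \<and> cut_free S \<and> atomically_testable S [A] \<and>
            switching_of S \<sigma> \<and>
            natural_partition T (daimon_partition T) =
              natural_partition S (switching_partition S \<sigma>))}"

end

theory Submission
  imports Defs
begin

text \<open>
  A cut-free net is correct as soon as it can be parsed into a single daimon: a par link whose
  premises are outputs of one daimon is absorbed by this daimon, and a tensor link whose premises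
  are outputs of two different daimons merges them. Suppose that no parsing step applies, and that
  there is one more daimon than tensor links, as in a net whose switchings are trees. Every tensor
  link then has premises in at most one daimon, so if each daimon had an output that is a premise
  of a tensor link, there would be at most as many daimons as tensor links. Hence some daimon has
  no such output, and switching every par link away from it disconnects it from the other daimons.

  So an incorrect net either has the wrong number of daimons or is split into two parts by some
  switching. Take the tests whose daimons are the blocks of this switching on each conclusion. Both
  defects can be read off a labelling of the interaction by formulas over two colours, and both are
  invariant under homogeneous cut elimination. A normal form without cyclic cuts consists of
  daimons without outputs, and a single one of them has neither defect.
\<close>

section \<open>Degrees of positions\<close>

text \<open>The two colours stand for the two sides of a disconnected switching, and formulas over
  them carry the colouring from \<open>S\<close> into the tests. The involution on colours is
  \<open>id\<close>: a cut joins positions with labels of dual shape and equal colours, so merging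
  two daimons across a cut never mixes colours. Dual labels also exclude cuts between a daimon and a
  connective, so the homogeneous rules suffice.

  The count of daimons is an Euler characteristic: an acyclic switching has as many components as
  daimons, less tensors and cuts, and it should have one. The pars of a formula become the tensors
  of its test, and each of them splits off one further block, so a test has one daimon more than
  tensors. Joining \<open>n\<close> tests by \<open>n\<close> cuts therefore leaves the
  characteristic of \<open>S\<close> unchanged.

  What shapes the sequentialization is that parsing consumes the net from the daimons downwards,
  whereas correctness is inductive from the last rule. The bridge is substitution: a derivation of a
  small net can replace a daimon inside another derivation.\<close>

lemma multi_member_split2:
  assumes "k \<in># M" "l \<in># M - {#k#}"
  obtains L where "M = {#k, l#} + L"
proof -
  have "M = add_mset k (add_mset l (M - {#k#} - {#l#}))"
    using assms by (metis insert_DiffM)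
  then show thesis
    using that by simp
qed

lemma multi_member_split2':
  assumes "k \<in># M" "l \<in># M" "k \<noteq> l"
  obtains L where "M = {#k, l#} + L"
  using multi_member_split2[OF assms(1), of l] assms that by (auto simp: in_diff_count)

lemma multi_member_split3:
  assumes "k \<in># M" "l \<in># M" "m \<in># M" "distinct [k, l, m]"
  obtains L where "M = {#k, l, m#} + L"
proof -
  obtain L where L: "M = {#k, l#} + L"
    using multi_member_split2'[of k M l] assms by auto
  then have "m \<in># L"
    using assms by auto
  then show thesis
    using that L by (auto dest!: multi_member_split)
qed

definition out_deg :: "'p link multiset \<Rightarrow> 'p \<Rightarrow> nat" where
  "out_deg L p = size {#l \<in># L. p \<in> set (outputs l)#}"

definition in_deg :: "'p link multiset \<Rightarrow> 'p \<Rightarrow> nat" where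
  "in_deg L p = size {#l \<in># L. p \<in> set (inputs l)#}"

lemma out_deg_simps [simp]:
  "out_deg {#} p = 0"
  "out_deg (add_mset l L) p = (if p \<in> set (outputs l) then 1 else 0) + out_deg L p"
  "out_deg (L + M) p = out_deg L p + out_deg M p"
  by (simp_all add: out_deg_def)

lemma in_deg_simps [simp]:
  "in_deg {#} p = 0"
  "in_deg (add_mset l L) p = (if p \<in> set (inputs l) then 1 else 0) + in_deg L p"
  "in_deg (L + M) p = in_deg L p + in_deg M p"
  by (simp_all add: in_deg_def)

lemma out_deg_pos_iff: "0 < out_deg L p \<longleftrightarrow> (\<exists>l \<in># L. p \<in> set (outputs l))"
  by (induction L) auto

lemma in_deg_pos_iff: "0 < in_deg L p \<longleftrightarrow> (\<exists>l \<in># L. p \<in> set (inputs l))"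
  by (induction L) auto

text \<open>Degrees make the net conditions additive in the links, so that exchanging a few links
  becomes arithmetic. Non-emptiness is kept separate because the empty sum at the end of
  \<open>parallel_list\<close> has to be wired as well.\<close>

definition wired :: "'p net \<Rightarrow> bool" where
  "wired S \<longleftrightarrow>
     (\<forall>l \<in># links S. wf_link l) \<and> distinct (conclusions S) \<and>
     (\<forall>p. in_deg (links S) p \<le> out_deg (links S) p \<and> out_deg (links S) p \<le> 1 \<and>
          (p \<in> set (conclusions S) \<longleftrightarrow> in_deg (links S) p < out_deg (links S) p))"

lemma positions_iff: "p \<in> positions S \<longleftrightarrow> 0 < in_deg (links S) p \<or> 0 < out_deg (links S) p"
  unfolding positions_def in_deg_pos_iff out_deg_pos_iff by blast

lemma positions_simps [simp]:
  "positions (Net {#} C) = {}"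
  "positions (Net (add_mset l L) C) = set (inputs l) \<union> set (outputs l) \<union> positions (Net L [])"
  "positions (Net (L + M) C) = positions (Net L []) \<union> positions (Net M [])"
  by (auto simp: positions_def)

lemma positions_conclusions: "NO_MATCH [] C \<Longrightarrow> positions (Net L C) = positions (Net L [])"
  by (simp add: positions_def)

lemma is_net_iff: "is_net S \<longleftrightarrow> links S \<noteq> {#} \<and> wired S"
proof -
  let ?i = "in_deg (links S)" and ?o = "out_deg (links S)" and ?C = "set (conclusions S)"
  have input: "(\<forall>l \<in># links S. p \<notin> set (inputs l)) \<longleftrightarrow> ?i p = 0" for p
    using in_deg_pos_iff[of "links S" p] by auto
  have "(p \<in> positions S \<longrightarrow> ?o p = 1 \<and> ?i p \<le> 1) \<and> (p \<in> ?C \<longleftrightarrow> p \<in> positions S \<and> ?i p = 0) \<longleftrightarrow>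
      ?i p \<le> ?o p \<and> ?o p \<le> 1 \<and> (p \<in> ?C \<longleftrightarrow> ?i p < ?o p)" for p
    unfolding positions_iff by (cases "p \<in> ?C") auto
  then have "(\<forall>p \<in> positions S. ?o p = 1 \<and> ?i p \<le> 1) \<and> ?C = {p \<in> positions S. ?i p = 0} \<longleftrightarrow>
      (\<forall>p. ?i p \<le> ?o p \<and> ?o p \<le> 1 \<and> (p \<in> ?C \<longleftrightarrow> ?i p < ?o p))"
    unfolding set_eq_iff mem_Collect_eq Ball_def all_conj_distrib[symmetric] by (rule arg_cong[of _ _ All, OF ext])
  then show ?thesis
    unfolding is_net_def wired_def input out_deg_def[symmetric] in_deg_def[symmetric] by satx
qed

lemma wired_wf: "wired S \<Longrightarrow> l \<in># links S \<Longrightarrow> wf_link l"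
  by (simp add: wired_def)

lemma wired_out_le: "wired S \<Longrightarrow> out_deg (links S) p \<le> 1"
  and wired_in_le_out: "wired S \<Longrightarrow> in_deg (links S) p \<le> out_deg (links S) p"
  by (simp_all add: wired_def)

lemma wired_same_output:
  assumes "wired S" "l \<in># links S" "k \<in># links S" "p \<in> set (outputs l)" "p \<in> set (outputs k)"
  shows "l = k"
proof (rule ccontr)
  assume "l \<noteq> k"
  then obtain L where "links S = {#l, k#} + L"
    using assms(2,3) multi_member_split2' by metis
  then show False
    using wired_out_le[OF assms(1), of p] assms(4,5) by simp
qed

lemma wired_producer:
  assumes "wired S" "l \<in># links S" "p \<in> set (inputs l)"
  obtains k where "k \<in># links S" "p \<in> set (outputs k)"
proof -
  have "0 < in_deg (links S) p"
    using assms(2,3) in_deg_pos_iff by fast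
  then have "0 < out_deg (links S) p"
    using wired_in_le_out[OF assms(1), of p] by simp
  then show thesis
    using that out_deg_pos_iff by metis
qed

section \<open>Sequentializable nets\<close>

text \<open>\<open>proves\<close> and \<open>represents\<close> fused along a fixed labelling, for
  derivations without cut. Permutations in place of adjacent exchanges free the later arguments from
  the order of the conclusions.\<close>

inductive seq :: "('p \<Rightarrow> 'x formula) \<Rightarrow> 'p net \<Rightarrow> bool" for \<tau> :: "'p \<Rightarrow> 'x formula" where
  daimon: "distinct ps \<Longrightarrow> seq \<tau> (Net {#Daimon ps#} ps)"
| par:
    "seq \<tau> (Net L (C @ [p1, p2])) \<Longrightarrow> p \<notin> positions (Net L (C @ [p1, p2])) \<Longrightarrow>
     \<tau> p = FPar (\<tau> p1) (\<tau> p2) \<Longrightarrow> seq \<tau> (Net (add_mset (Par p1 p2 p) L) (C @ [p]))"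
| tensor:
    "seq \<tau> (Net L (C @ [p1])) \<Longrightarrow> seq \<tau> (Net M (D @ [p2])) \<Longrightarrow>
     positions (Net L (C @ [p1])) \<inter> positions (Net M (D @ [p2])) = {} \<Longrightarrow>
     p \<notin> positions (Net L (C @ [p1])) \<union> positions (Net M (D @ [p2])) \<Longrightarrow>
     \<tau> p = FTensor (\<tau> p1) (\<tau> p2) \<Longrightarrow>
     seq \<tau> (Net (add_mset (Tensor p1 p2 p) (L + M)) (C @ D @ [p]))"
| permute: "seq \<tau> (Net L C) \<Longrightarrow> mset C = mset D \<Longrightarrow> seq \<tau> (Net L D)"

text \<open>A selection sort: the prefix \<open>zs\<close> collects what is already in place, and
  adjacent swaps carry the next element to the end of it.\<close>

lemma adjacent_swaps_permute:
  assumes swap: "\<And>xs x y ys. P (xs @ [x, y] @ ys) \<Longrightarrow> P (xs @ [y, x] @ ys)"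
  shows "P (zs @ xs) \<Longrightarrow> mset xs = mset ys \<Longrightarrow> P (zs @ ys)"
proof (induction ys arbitrary: zs xs)
  case Nil
  then show ?case by simp
next
  case (Cons y ys)
  from Cons.prems(2) have "y \<in> set xs"
    by (metis list.set_intros(1) set_mset_mset)
  then obtain us vs where xs: "xs = us @ y # vs"
    by (meson split_list)
  have "P (zs @ us @ y # vs) \<Longrightarrow> P (zs @ y # us @ vs)" for us vs
  proof (induction us arbitrary: vs rule: rev_induct)
    case (snoc u us)
    then show ?case
      using swap[of "zs @ us" u y vs] by simp
  qed simp
  with Cons.prems(1) xs have "P ((zs @ [y]) @ us @ vs)"
    by simp
  moreover have "mset (us @ vs) = mset ys"
    using Cons.prems(2) xs by simp
  ultimately show ?case
    using Cons.IH[of "zs @ [y]" "us @ vs"] by simp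
qed

lemma seq_represents:
  "seq \<tau> S \<Longrightarrow> \<exists>\<pi>. proves perp \<pi> (map \<tau> (conclusions S)) \<and> represents S \<pi>"
proof (induction rule: seq.induct)
  case (daimon ps)
  then show ?case
    using proves.daimon represents.daimon[of ps "map \<tau> ps"] by fastforce
next
  case (par L C p1 p2 p)
  then obtain \<pi> where "proves perp \<pi> (map \<tau> C @ [\<tau> p1, \<tau> p2])" "represents (Net L (C @ [p1, p2])) \<pi>"
    by auto
  with par show ?case
    using proves.par[of perp \<pi> "map \<tau> C" "\<tau> p1" "\<tau> p2"] represents.par[of L C p1 p2 \<pi> p] by auto
next
  case (tensor L C p1 M D p2 p)
  then obtain \<pi> \<rho> where "proves perp \<pi> (map \<tau> C @ [\<tau> p1])" "represents (Net L (C @ [p1])) \<pi>"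
    "proves perp \<rho> (map \<tau> D @ [\<tau> p2])" "represents (Net M (D @ [p2])) \<rho>"
    by auto
  with tensor show ?case
    using proves.tensor[of perp \<pi> "map \<tau> C" "\<tau> p1" \<rho> "map \<tau> D" "\<tau> p2"]
      represents.tensor[of L C p1 \<pi> M D p2 \<rho> p] by auto
next
  case (permute L C D)
  let ?P = "\<lambda>C. \<exists>\<pi>. proves perp \<pi> (map \<tau> C) \<and> represents (Net L C) \<pi>"
  have "?P (xs @ [y, x] @ ys)" if xy: "?P (xs @ [x, y] @ ys)" for xs x y ys
  proof -
    obtain \<pi> where "proves perp \<pi> (map \<tau> xs @ [\<tau> x, \<tau> y] @ map \<tau> ys)"
      "represents (Net L (xs @ [x, y] @ ys)) \<pi>"
      using xy by auto
    then show ?thesis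
      using proves.exchange[of perp \<pi> "map \<tau> xs" "\<tau> x" "\<tau> y" "map \<tau> ys"]
        represents.exchange[of L xs x y ys \<pi>] by (intro exI[of _ "ExR (length xs) \<pi>"]) auto
  qed
  from adjacent_swaps_permute[of ?P "[]" C D, OF this] permute show ?case
    by simp
qed

text \<open>A derivation with the same conclusions may be grafted onto a daimon leaf; this is how a
  parsing step is undone. The last hypothesis keeps the positions internal to the graft away from
  \<open>N\<close>, so the freshness and disjointness conditions of the rules survive.\<close>

lemma seq_substitute:
  assumes "seq \<tau> N" "links N = add_mset (Daimon ps) L"
    and "seq \<tau> (Net M D)" "mset D = mset ps"
    and "positions (Net M D) \<inter> positions N \<subseteq> set ps"
  shows "seq \<tau> (Net (L + M) (conclusions N))"
  using assms
proof (induction arbitrary: L rule: seq.induct)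
  case (daimon qs)
  then show ?case
    using seq.permute[of \<tau> M D qs] by auto
next
  case (par L0 C p1 p2 p)
  obtain L1 where L: "L0 = add_mset (Daimon ps) L1" "L = add_mset (Par p1 p2 p) L1"
    using par.prems(1) by (auto simp: add_eq_conv_ex)
  have "seq \<tau> (Net (L1 + M) (C @ [p1, p2]))"
    using par.IH[of L1] par.prems L by (auto simp: positions_conclusions)
  moreover have "p \<notin> positions (Net (L1 + M) (C @ [p1, p2]))"
    using par.hyps par.prems L by (auto simp: positions_conclusions)
  ultimately show ?case
    using seq.par[of \<tau> "L1 + M" C p1 p2 p] par.hyps L by simp
next
  case (tensor L0 C p1 M0 D0 p2 p)
  have "Daimon ps \<in># L0 + M0"
    using arg_cong[OF tensor.prems(1), of "\<lambda>K. Daimon ps \<in># K"] by simp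
  then consider "Daimon ps \<in># L0" | "Daimon ps \<in># M0"
    by auto
  then show ?case
  proof cases
    case 1
    then obtain L1 where L0: "L0 = add_mset (Daimon ps) L1"
      by (metis insert_DiffM)
    have "add_mset (Daimon ps) L = add_mset (Daimon ps) (add_mset (Tensor p1 p2 p) (L1 + M0))"
      using tensor.prems(1) L0 by (simp add: add_mset_commute)
    then have L: "L = add_mset (Tensor p1 p2 p) (L1 + M0)"
      by (rule add_mset_add_mset_same_iff[THEN iffD1])
    have "seq \<tau> (Net (L1 + M) (C @ [p1]))"
      using tensor.IH(1)[of L1] tensor.prems L0 by (auto simp: positions_conclusions)
    moreover have "positions (Net (L1 + M) (C @ [p1])) \<inter> positions (Net M0 (D0 @ [p2])) = {}"
      "p \<notin> positions (Net (L1 + M) (C @ [p1])) \<union> positions (Net M0 (D0 @ [p2]))"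
      using tensor.hyps tensor.prems L0 by (simp_all add: positions_conclusions; blast)+
    ultimately have "seq \<tau> (Net (add_mset (Tensor p1 p2 p) ((L1 + M) + M0)) (C @ D0 @ [p]))"
      using seq.tensor tensor.hyps by metis
    then show ?thesis
      by (simp add: L ac_simps)
  next
    case 2
    then obtain M1 where M0: "M0 = add_mset (Daimon ps) M1"
      by (metis insert_DiffM)
    have "add_mset (Daimon ps) L = add_mset (Daimon ps) (add_mset (Tensor p1 p2 p) (L0 + M1))"
      using tensor.prems(1) M0 by (simp add: add_mset_commute)
    then have L: "L = add_mset (Tensor p1 p2 p) (L0 + M1)"
      by (rule add_mset_add_mset_same_iff[THEN iffD1])
    have "seq \<tau> (Net (M1 + M) (D0 @ [p2]))"
      using tensor.IH(2)[of M1] tensor.prems M0 by (auto simp: positions_conclusions)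
    moreover have "positions (Net L0 (C @ [p1])) \<inter> positions (Net (M1 + M) (D0 @ [p2])) = {}"
      "p \<notin> positions (Net L0 (C @ [p1])) \<union> positions (Net (M1 + M) (D0 @ [p2]))"
      using tensor.hyps tensor.prems M0 by (simp_all add: positions_conclusions; blast)+
    ultimately have "seq \<tau> (Net (add_mset (Tensor p1 p2 p) (L0 + (M1 + M))) (C @ D0 @ [p]))"
      using seq.tensor tensor.hyps by metis
    then show ?thesis
      by (simp add: L ac_simps)
  qed
next
  case (permute L0 C C')
  then show ?case
    using seq.permute[of \<tau> "L + M" C C'] by (simp add: positions_conclusions)
qed

section \<open>Colourings\<close>

primrec is_daimon :: "'p link \<Rightarrow> bool" where
  "is_daimon (Tensor p1 p2 p) = False"
| "is_daimon (Par p1 p2 p) = False"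
| "is_daimon (Cut p q) = False"
| "is_daimon (Daimon ps) = True"

primrec is_tensor :: "'p link \<Rightarrow> bool" where
  "is_tensor (Tensor p1 p2 p) = True"
| "is_tensor (Par p1 p2 p) = False"
| "is_tensor (Cut p q) = False"
| "is_tensor (Daimon ps) = False"

primrec is_cut :: "'p link \<Rightarrow> bool" where
  "is_cut (Tensor p1 p2 p) = False"
| "is_cut (Par p1 p2 p) = False"
| "is_cut (Cut p q) = True"
| "is_cut (Daimon ps) = False"

definition daimons :: "'p link multiset \<Rightarrow> nat" where
  "daimons L = size (filter_mset is_daimon L)"

definition tensors :: "'p link multiset \<Rightarrow> nat" where
  "tensors L = size (filter_mset is_tensor L)"

definition cuts :: "'p link multiset \<Rightarrow> nat" where
  "cuts L = size (filter_mset is_cut L)"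

lemma daimons_simps [simp]:
  "daimons {#} = 0" "daimons (add_mset l L) = (if is_daimon l then 1 else 0) + daimons L"
  "daimons (L + M) = daimons L + daimons M"
  by (simp_all add: daimons_def)

lemma tensors_simps [simp]:
  "tensors {#} = 0" "tensors (add_mset l L) = (if is_tensor l then 1 else 0) + tensors L"
  "tensors (L + M) = tensors L + tensors M"
  by (simp_all add: tensors_def)

lemma cuts_simps [simp]:
  "cuts {#} = 0" "cuts (add_mset l L) = (if is_cut l then 1 else 0) + cuts L"
  "cuts (L + M) = cuts L + cuts M"
  by (simp_all add: cuts_def)

lemma daimons_pos_iff: "0 < daimons L \<longleftrightarrow> (\<exists>ps. Daimon ps \<in># L)"
proof (induction L)
  case (add l L)
  then show ?case
    by (cases l) auto
qed simp

text \<open>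
  A colouring records, for some choice of a switching, to which side of a splitting of the
  switched net each position belongs; the premise of a par link that keeps the colour of the
  conclusion is the one that remains connected to it.
\<close>

primrec link_coloured :: "('p \<Rightarrow> bool) \<Rightarrow> 'p link \<Rightarrow> bool" where
  "link_coloured c (Tensor p1 p2 p) \<longleftrightarrow> c p1 = c p \<and> c p2 = c p"
| "link_coloured c (Par p1 p2 p) \<longleftrightarrow> c p1 = c p \<or> c p2 = c p"
| "link_coloured c (Cut p q) \<longleftrightarrow> True"
| "link_coloured c (Daimon ps) \<longleftrightarrow> (\<exists>b. \<forall>p \<in> set ps. c p = b)"

text \<open>A daimon without outputs has both colours vacuously; \<open>2 \<le> daimons L\<close>
  prevents such a daimon alone from counting as disconnected.\<close>

definition disconnecting :: "('p \<Rightarrow> bool) \<Rightarrow> 'p link multiset \<Rightarrow> bool" where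
  "disconnecting c L \<longleftrightarrow>
     (\<forall>l \<in># L. link_coloured c l) \<and> 2 \<le> daimons L \<and>
     (\<forall>b. \<exists>ps. Daimon ps \<in># L \<and> (\<forall>p \<in> set ps. c p = b))"

lemma link_coloured_cong:
  "(\<And>p. p \<in> set (inputs l) \<union> set (outputs l) \<Longrightarrow> c p = c' p) \<Longrightarrow>
   link_coloured c l = link_coloured c' l"
  by (cases l) auto

lemma wired_distinct_daimon: "wired S \<Longrightarrow> Daimon ps \<in># links S \<Longrightarrow> distinct ps"
  using wired_wf[of S "Daimon ps"] by (simp add: wf_link_def)

lemma fresh_link_positions:
  "out_deg L q = 0 \<Longrightarrow> in_deg L q = 0 \<Longrightarrow> l \<in># L \<Longrightarrow> p \<in> set (inputs l) \<union> set (outputs l) \<Longrightarrow> p \<noteq> q"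
  using out_deg_pos_iff[of L q] in_deg_pos_iff[of L q] by auto

text \<open>Pulls a disconnecting colouring back through a parsing step. \<open>X\<close> holds the
  absorbed premises and \<open>M\<close> the links that were replaced by
  \<open>Daimon (p # ps)\<close>; the premises take the colour of \<open>p\<close>, and
  \<open>qs\<close> takes over from the collapsed daimon as witness of a colour.\<close>

lemma disconnecting_expand:
  assumes c: "disconnecting c (add_mset (Daimon (p # ps)) L)"
    and fresh: "\<And>x. x \<in> X \<Longrightarrow> out_deg L x = 0 \<and> in_deg L x = 0"
  defines "c' \<equiv> \<lambda>x. if x \<in> X then c p else c x"
  assumes M: "\<And>l. l \<in># M \<Longrightarrow> link_coloured c' l" "1 \<le> daimons M"
    and qs: "Daimon qs \<in># M" "set qs \<subseteq> X \<union> set (p # ps)"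
  shows "disconnecting c' (M + L)"
  unfolding disconnecting_def
proof (intro conjI allI ballI)
  have eq: "c' x = c x" if "l \<in># L" "x \<in> set (inputs l) \<union> set (outputs l)" for l x
    using fresh_link_positions[OF _ _ that] fresh by (auto simp: c'_def)
  have "link_coloured c' l = link_coloured c l" if "l \<in># L" for l
    using eq[OF that] by (rule link_coloured_cong)
  then show "link_coloured c' l" if "l \<in># M + L" for l
    using that M(1) c by (auto simp: disconnecting_def)
  show "2 \<le> daimons (M + L)"
    using c M(2) by (simp add: disconnecting_def)
  fix b
  obtain rs where rs: "Daimon rs \<in># add_mset (Daimon (p # ps)) L" "\<forall>q \<in> set rs. c q = b"
    using c unfolding disconnecting_def by blast
  show "\<exists>rs. Daimon rs \<in># M + L \<and> (\<forall>q \<in> set rs. c' q = b)"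
  proof (cases "Daimon rs \<in># L")
    case True
    then show ?thesis
      using rs(2) eq[OF True] by (intro exI[of _ rs]) auto
  next
    case False
    then have "\<forall>q \<in> set (p # ps). c q = b"
      using rs by auto
    then show ?thesis
      using qs by (intro exI[of _ qs]) (auto simp: c'_def)
  qed
qed

section \<open>Sequentialization\<close>

text \<open>A disconnecting colouring of the parsed net extends to \<open>S\<close> by giving
  \<open>p1\<close> and \<open>p2\<close> the colour of \<open>p\<close>. A derivation of the parsed
  net extends by grafting the old daimon, followed by the par link, onto the new daimon.\<close>

lemma parse_par:
  fixes L1 :: "'p link multiset"
  assumes "wired S" and L: "links S = {#Par p1 p2 p, Daimon ps#} + L1"
    and p12: "p1 \<in> set ps" "p2 \<in> set ps"
  defines "ps' \<equiv> remove1 p1 (remove1 p2 ps)"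
  defines "L' \<equiv> add_mset (Daimon (p # ps')) L1"
  shows "wired (Net L' (conclusions S))"
    and "disconnecting c L' \<Longrightarrow> \<exists>c. disconnecting c (links S)"
    and "seq \<tau> (Net L' (conclusions S)) \<Longrightarrow> \<tau> p = FPar (\<tau> p1) (\<tau> p2) \<Longrightarrow> seq \<tau> S"
proof -
  have dist: "distinct ps"
    using wired_distinct_daimon[OF \<open>wired S\<close>] L by simp
  then have ps': "set ps' = set ps - {p1, p2}" "distinct ps'"
    by (auto simp: ps'_def)
  have neq: "p1 \<noteq> p2" "p \<noteq> p1" "p \<noteq> p2"
    using wired_wf[OF \<open>wired S\<close>, of "Par p1 p2 p"] L by (auto simp: wf_link_def)
  have deg: "in_deg (links S) x \<le> out_deg (links S) x" "out_deg (links S) x \<le> 1"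
    "x \<in> set (conclusions S) \<longleftrightarrow> in_deg (links S) x < out_deg (links S) x" for x
    using \<open>wired S\<close> by (simp_all add: wired_def)
  have p: "p \<notin> set ps" "out_deg L1 p = 0"
    using deg(2)[of p] L by (auto split: if_splits)
  \<comment> \<open>Both premises are produced by \<open>ps\<close> and consumed by the par link,
    which exhausts their degrees.\<close>
  have p12': "out_deg L1 p1 = 0" "in_deg L1 p1 = 0" "out_deg L1 p2 = 0" "in_deg L1 p2 = 0"
    using deg(1,2)[of p1] deg(1,2)[of p2] L p12 neq by (auto split: if_splits)
  have "in_deg L' x \<le> out_deg L' x \<and> out_deg L' x \<le> 1 \<and>
      (x \<in> set (conclusions S) \<longleftrightarrow> in_deg L' x < out_deg L' x)" for x
    using deg[of x] L p12 p12' p neq ps' by (auto simp: L'_def split: if_splits)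
  moreover have "\<forall>l \<in># L'. wf_link l"
    using wired_wf[OF \<open>wired S\<close>] L ps' p by (auto simp: L'_def wf_link_def)
  ultimately show "wired (Net L' (conclusions S))"
    using \<open>wired S\<close> by (simp add: wired_def)
  show "\<exists>c. disconnecting c (links S)" if c: "disconnecting c L'"
  proof -
    let ?c = "\<lambda>x. if x \<in> {p1, p2} then c p else c x"
    have "\<forall>x \<in> set (p # ps'). c x = c p"
      using c by (auto simp: disconnecting_def L'_def)
    then have col: "\<forall>x \<in> set ps. ?c x = c p" "?c p = c p"
      using ps' by auto
    then have "link_coloured ?c (Daimon ps)"
      unfolding link_coloured.simps by blast
    moreover have "link_coloured ?c (Par p1 p2 p)"
      using col(2) by simp
    ultimately have "link_coloured ?c l" if "l \<in># {#Par p1 p2 p, Daimon ps#}" for l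
      using that by (auto simp del: link_coloured.simps split del: if_split)
    then have "disconnecting ?c ({#Par p1 p2 p, Daimon ps#} + L1)"
      using p12' ps' c unfolding L'_def by (intro disconnecting_expand[where qs = ps]) auto
    then show ?thesis
      using L by auto
  qed
  show "seq \<tau> S" if s: "seq \<tau> (Net L' (conclusions S))" "\<tau> p = FPar (\<tau> p1) (\<tau> p2)"
  proof -
    have "mset ps = mset (ps' @ [p1, p2])"
      using p12 neq dist ps' by (subst set_eq_iff_mset_eq_distinct[symmetric]) auto
    then have "seq \<tau> (Net {#Daimon ps#} (ps' @ [p1, p2]))"
      using seq.permute seq.daimon dist by metis
    then have "seq \<tau> (Net {#Par p1 p2 p, Daimon ps#} (ps' @ [p]))"
      using p(1) p12 s(2) by (intro seq.par) auto
    moreover have "positions (Net {#Par p1 p2 p, Daimon ps#} (ps' @ [p])) \<inter>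
        positions (Net L' (conclusions S)) \<subseteq> set (p # ps')"
      using p12' ps'(1) positions_iff[of p1 "Net L1 []"] positions_iff[of p2 "Net L1 []"]
      by (auto simp: L'_def)
    ultimately have "seq \<tau> (Net (L1 + {#Par p1 p2 p, Daimon ps#}) (conclusions S))"
      using seq_substitute[OF s(1), of "p # ps'" L1 "{#Par p1 p2 p, Daimon ps#}" "ps' @ [p]"] by (simp add: L'_def)
    then show ?thesis
      using L by (cases S) (simp add: ac_simps)
  qed
qed

text \<open>As for par links, but two occurrences of daimons are merged; their outputs are disjoint,
  as the tensor rule demands of its two premises.\<close>

lemma parse_tensor:
  fixes L1 :: "'p link multiset"
  assumes "wired S" and L: "links S = {#Tensor p1 p2 p, Daimon ps, Daimon qs#} + L1"
    and p12: "p1 \<in> set ps" "p2 \<in> set qs"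
  defines "ps' \<equiv> remove1 p1 ps" and "qs' \<equiv> remove1 p2 qs"
  defines "L' \<equiv> add_mset (Daimon (p # ps' @ qs')) L1"
  shows "wired (Net L' (conclusions S))"
    and "disconnecting c L' \<Longrightarrow> \<exists>c. disconnecting c (links S)"
    and "seq \<tau> (Net L' (conclusions S)) \<Longrightarrow> \<tau> p = FTensor (\<tau> p1) (\<tau> p2) \<Longrightarrow> seq \<tau> S"
proof -
  have dist: "distinct ps" "distinct qs"
    using wired_distinct_daimon[OF \<open>wired S\<close>] L by simp_all
  then have ps': "set ps' = set ps - {p1}" "distinct ps'" "set qs' = set qs - {p2}" "distinct qs'"
    by (auto simp: ps'_def qs'_def)
  have neq: "p1 \<noteq> p2" "p \<noteq> p1" "p \<noteq> p2"
    using wired_wf[OF \<open>wired S\<close>, of "Tensor p1 p2 p"] L by (auto simp: wf_link_def)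
  have deg: "in_deg (links S) x \<le> out_deg (links S) x" "out_deg (links S) x \<le> 1"
    "x \<in> set (conclusions S) \<longleftrightarrow> in_deg (links S) x < out_deg (links S) x" for x
    using \<open>wired S\<close> by (simp_all add: wired_def)
  have p: "p \<notin> set ps" "p \<notin> set qs" "out_deg L1 p = 0"
    using deg(2)[of p] L by (auto split: if_splits)
  have disj: "set ps \<inter> set qs = {}"
  proof (rule equals0I)
    fix x assume "x \<in> set ps \<inter> set qs"
    then show False
      using deg(2)[of x] L by (auto split: if_splits)
  qed
  have p12': "out_deg L1 p1 = 0" "in_deg L1 p1 = 0" "out_deg L1 p2 = 0" "in_deg L1 p2 = 0"
    using deg(1,2)[of p1] deg(1,2)[of p2] L p12 neq by (auto split: if_splits)
  have "in_deg L' x \<le> out_deg L' x \<and> out_deg L' x \<le> 1 \<and>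
      (x \<in> set (conclusions S) \<longleftrightarrow> in_deg L' x < out_deg L' x)" for x
    using deg[of x] L p12 p12' p neq ps' disj by (auto simp: L'_def split: if_splits)
  moreover have "\<forall>l \<in># L'. wf_link l"
    using wired_wf[OF \<open>wired S\<close>] L ps' p disj by (auto simp: L'_def wf_link_def)
  ultimately show "wired (Net L' (conclusions S))"
    using \<open>wired S\<close> by (simp add: wired_def)
  show "\<exists>c. disconnecting c (links S)" if c: "disconnecting c L'"
  proof -
    let ?c = "\<lambda>x. if x \<in> {p1, p2} then c p else c x"
    have "\<forall>x \<in> set (p # ps' @ qs'). c x = c p"
      using c by (auto simp: disconnecting_def L'_def)
    then have col: "\<forall>x \<in> set ps \<union> set qs. ?c x = c p" "?c p = c p"
      using ps' by auto
    then have "link_coloured ?c (Daimon ps)" "link_coloured ?c (Daimon qs)"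
      unfolding link_coloured.simps by blast+
    moreover have "link_coloured ?c (Tensor p1 p2 p)"
      using col(2) by simp
    ultimately have "link_coloured ?c l" if "l \<in># {#Tensor p1 p2 p, Daimon ps, Daimon qs#}" for l
      using that by (auto simp del: link_coloured.simps split del: if_split)
    then have "disconnecting ?c ({#Tensor p1 p2 p, Daimon ps, Daimon qs#} + L1)"
      using p12' ps' c unfolding L'_def by (intro disconnecting_expand[where qs = ps]) auto
    then show ?thesis
      using L by auto
  qed
  show "seq \<tau> S" if s: "seq \<tau> (Net L' (conclusions S))" "\<tau> p = FTensor (\<tau> p1) (\<tau> p2)"
  proof -
    have "mset ps = mset (ps' @ [p1])" "mset qs = mset (qs' @ [p2])"
      using p12 by (simp_all add: ps'_def qs'_def)
    then have "seq \<tau> (Net {#Daimon ps#} (ps' @ [p1]))" "seq \<tau> (Net {#Daimon qs#} (qs' @ [p2]))"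
      using seq.permute seq.daimon dist by metis+
    then have "seq \<tau> (Net (add_mset (Tensor p1 p2 p) ({#Daimon ps#} + {#Daimon qs#})) (ps' @ qs' @ [p]))"
      using p p12 s(2) disj by (intro seq.tensor) auto
    then have "seq \<tau> (Net {#Tensor p1 p2 p, Daimon ps, Daimon qs#} (ps' @ qs' @ [p]))"
      by (simp add: add_mset_commute)
    moreover have "positions (Net {#Tensor p1 p2 p, Daimon ps, Daimon qs#} (ps' @ qs' @ [p])) \<inter>
        positions (Net L' (conclusions S)) \<subseteq> set (p # ps' @ qs')"
      using p12' ps' positions_iff[of p1 "Net L1 []"] positions_iff[of p2 "Net L1 []"]
      by (auto simp: L'_def)
    ultimately have "seq \<tau> (Net (L1 + {#Tensor p1 p2 p, Daimon ps, Daimon qs#}) (conclusions S))"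
      using seq_substitute[OF s(1), of "p # ps' @ qs'" L1
          "{#Tensor p1 p2 p, Daimon ps, Daimon qs#}" "ps' @ qs' @ [p]"] by (simp add: L'_def)
    then show ?thesis
      using L by (cases S) (simp add: ac_simps)
  qed
qed

text \<open>Double counting of the incidences between daimons and tensor links: every daimon has
  one, and no tensor link has two.\<close>

lemma daimons_le_tensors:
  assumes S: "wired S"
    and irred: "\<And>p1 p2 p ps qs L1. links S = {#Tensor p1 p2 p, Daimon ps, Daimon qs#} + L1 \<Longrightarrow>
      p1 \<notin> set ps \<or> p2 \<notin> set qs"
    and used: "\<And>ps. Daimon ps \<in># links S \<Longrightarrow>
      \<exists>p1 p2 p. Tensor p1 p2 p \<in># links S \<and> (p1 \<in> set ps \<or> p2 \<in> set ps)"
  shows "daimons (links S) \<le> tensors (links S)"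
proof -
  let ?D = "filter_mset is_daimon (links S)" and ?T = "filter_mset is_tensor (links S)"
  define f :: "'a link \<Rightarrow> 'a link \<Rightarrow> nat"
    where "f d t = (if set (outputs d) \<inter> set (inputs t) \<noteq> {} then 1 else 0)" for d t
  have one: "(\<Sum>d\<in>#M. 1) = size M" for M :: "'a link multiset"
    by (induction M) auto
  have ge: "1 \<le> (\<Sum>t\<in>#?T. f d t)" if dD: "d \<in># ?D" for d
  proof -
    obtain ps where d: "d = Daimon ps"
      using dD by (cases d) auto
    obtain p1 p2 p where t: "Tensor p1 p2 p \<in># links S" "p1 \<in> set ps \<or> p2 \<in> set ps"
      using used[of ps] dD d by auto
    then obtain T where "?T = add_mset (Tensor p1 p2 p) T"
      by (metis insert_DiffM filter_mset_add_mset is_tensor.simps(1))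
    then show ?thesis
      using t d by (auto simp: f_def)
  qed
  have le: "(\<Sum>d\<in>#?D. f d t) \<le> 1" if tT: "t \<in># ?T" for t
  proof -
    obtain p1 p2 p where t: "t = Tensor p1 p2 p"
      using tT by (cases t) auto
    have f: "(\<Sum>d\<in>#M. f d t) = size {#d \<in># M. set (outputs d) \<inter> set (inputs t) \<noteq> {}#}" for M
      by (induction M) (auto simp: f_def)
    \<comment> \<open>Two daimons meeting \<open>t\<close> either share a premise, against the bound
      on out-degrees, or own one premise each, against \<open>irred\<close> in one of the two
      orders.\<close>
    have "False" if two: "2 \<le> size {#d \<in># ?D. set (outputs d) \<inter> set (inputs t) \<noteq> {}#}"
    proof -
      obtain d M' where d: "{#d \<in># ?D. set (outputs d) \<inter> set (inputs t) \<noteq> {}#} = add_mset d M'"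
        using two by (cases "{#d \<in># ?D. set (outputs d) \<inter> set (inputs t) \<noteq> {}#}") auto
      then obtain e M where "M' = add_mset e M"
        using two by (cases M') auto
      with d have M: "{#d \<in># ?D. set (outputs d) \<inter> set (inputs t) \<noteq> {}#} = {#d, e#} + M"
        by simp
      have sub: "{#d, e#} \<subseteq># ?D"
        using M by (metis mset_subset_eq_add_left multiset_filter_subset subset_mset.order_trans)
      then have "{#d, e#} + {#t#} \<subseteq># ?D + ?T"
        using \<open>t \<in># ?T\<close> by (intro subset_mset.add_mono) simp_all
      moreover have "?D + ?T \<subseteq># links S"
      proof (rule mset_subset_eqI)
        show "count (?D + ?T) l \<le> count (links S) l" for l
          by (cases l) auto
      qed
      ultimately have "{#t, d, e#} \<subseteq># links S"
        by (auto simp: add_mset_commute dest: subset_mset.order_trans)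
      then obtain L1 where L1: "links S = {#t, d, e#} + L1"
        unfolding mset_subset_eq_exists_conv by blast
      have de: "is_daimon d" "is_daimon e" "set (outputs d) \<inter> set (inputs t) \<noteq> {}"
        "set (outputs e) \<inter> set (inputs t) \<noteq> {}"
      proof -
        have "d \<in># {#d, e#} + M" "e \<in># {#d, e#} + M"
          by auto
        then show "is_daimon d" "is_daimon e" "set (outputs d) \<inter> set (inputs t) \<noteq> {}"
        "set (outputs e) \<inter> set (inputs t) \<noteq> {}"
          unfolding M[symmetric] by auto
      qed
      obtain ps qs where ps: "d = Daimon ps" and qs: "e = Daimon qs"
        using de(1,2) by (cases d; cases e) auto
      have "p1 \<in> set ps \<or> p2 \<in> set ps" "p1 \<in> set qs \<or> p2 \<in> set qs"
        using de ps qs t by auto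
      moreover have "p1 \<notin> set ps \<or> p2 \<notin> set qs"
        using irred[of p1 p2 p ps qs L1] L1 t ps qs by simp
      moreover have "p1 \<notin> set qs \<or> p2 \<notin> set ps"
        using irred[of p1 p2 p qs ps L1] L1 t ps qs by (simp add: add_mset_commute)
      moreover have "x \<notin> set ps \<or> x \<notin> set qs" for x
        using wired_out_le[OF S, of x] L1 ps qs by auto
      ultimately show False
        by blast
    qed
    then show ?thesis
      unfolding f by force
  qed
  have "size ?D = (\<Sum>d\<in>#?D. 1)"
    by (simp add: one)
  also have "\<dots> \<le> (\<Sum>d\<in>#?D. \<Sum>t\<in>#?T. f d t)"
    using ge by (intro sum_mset_mono) 
  also have "\<dots> = (\<Sum>t\<in>#?T. \<Sum>d\<in>#?D. f d t)"
    by (rule sum_mset.swap)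
  also have "\<dots> \<le> (\<Sum>t\<in>#?T. 1)"
    using le by (intro sum_mset_mono) 
  finally show ?thesis
    by (simp add: one daimons_def tensors_def)
qed

text \<open>The equation on the counts survives parsing: absorbing a par link changes neither side,
  and merging across a tensor link lowers both by one. Each step also lowers the number of links,
  hence the induction.\<close>

theorem seq_or_disconnecting:
  fixes \<tau> :: "'p \<Rightarrow> 'x formula"
  assumes "wired S" "links S \<noteq> {#}" "cut_free S" "formula_labelling S \<tau>"
    and "daimons (links S) = tensors (links S) + 1"
    and "\<And>c. \<not> disconnecting c (links S)"
  shows "seq \<tau> S"
  using assms
proof (induction "size (links S)" arbitrary: S rule: less_induct)
  case less
  note S = \<open>wired S\<close> and count = less.prems(5) and conn = less.prems(6)
  have tau: "Par p1 p2 p \<in># links S \<Longrightarrow> \<tau> p = FPar (\<tau> p1) (\<tau> p2)"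
    "Tensor p1 p2 p \<in># links S \<Longrightarrow> \<tau> p = FTensor (\<tau> p1) (\<tau> p2)" for p1 p2 p
    using less.prems(4) by (auto simp: formula_labelling_def)
  consider (par) p1 p2 p ps L1 where "links S = {#Par p1 p2 p, Daimon ps#} + L1" "p1 \<in> set ps" "p2 \<in> set ps"
    | (tensor) p1 p2 p ps qs L1 where "links S = {#Tensor p1 p2 p, Daimon ps, Daimon qs#} + L1" "p1 \<in> set ps" "p2 \<in> set qs"
    | (irreducible)
      "\<And>p1 p2 p ps L1. links S = {#Par p1 p2 p, Daimon ps#} + L1 \<Longrightarrow> p1 \<notin> set ps \<or> p2 \<notin> set ps"
      "\<And>p1 p2 p ps qs L1. links S = {#Tensor p1 p2 p, Daimon ps, Daimon qs#} + L1 \<Longrightarrow>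
        p1 \<notin> set ps \<or> p2 \<notin> set qs"
    by metis
  then show ?case
  proof cases
    case par
    let ?S = "Net (add_mset (Daimon (p # remove1 p1 (remove1 p2 ps))) L1) (conclusions S)"
    note P = parse_par[OF S par]
    have "seq \<tau> ?S"
      using less.prems P(1,2) par by (intro less.hyps) (auto simp: cut_free_def formula_labelling_def)
    then show ?thesis
      using P(3)[OF _ tau(1)] par(1) by simp
  next
    case tensor
    let ?S = "Net (add_mset (Daimon (p # remove1 p1 ps @ remove1 p2 qs)) L1) (conclusions S)"
    note P = parse_tensor[OF S tensor]
    have "seq \<tau> ?S"
      using less.prems P(1,2) tensor by (intro less.hyps) (auto simp: cut_free_def formula_labelling_def)
    then show ?thesis
      using P(3)[OF _ tau(2)] tensor(1) by simp
  next
    case irreducible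
    have one: "daimons (links S) = 1"
    proof (rule ccontr)
      assume "daimons (links S) \<noteq> 1"
      then have two: "2 \<le> daimons (links S)"
        using count by simp
      have "\<exists>p1 p2 p. Tensor p1 p2 p \<in># links S \<and> (p1 \<in> set ps \<or> p2 \<in> set ps)"
        if ps: "Daimon ps \<in># links S" for ps
      proof (rule ccontr)
        assume isolated: "\<not> ?thesis"
        \<comment> \<open>One colour for the isolated daimon, the other for everything else. No
          output of a connective lies in \<open>ps\<close>, so a par link only has to have one
          premise outside \<open>ps\<close>, which irreducibility provides.\<close>
        let ?c = "\<lambda>x. x \<in> set ps"
        have other: "set qs \<inter> set ps = {}" if qs: "Daimon qs \<in># links S - {#Daimon ps#}" for qs
        proof (rule equals0I)
          fix x assume "x \<in> set qs \<inter> set ps"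
          moreover obtain L where "links S = {#Daimon ps, Daimon qs#} + L"
            by (rule multi_member_split2[OF ps qs])
          ultimately show False
            using wired_out_le[OF S, of x] by simp
        qed
        have out: "?c p \<longleftrightarrow> False" if "l \<in># links S" "l \<noteq> Daimon ps" "p \<in> set (outputs l)" for l p
          using wired_same_output[OF S that(1) ps that(3)] that(2) by auto
        have col: "link_coloured ?c l" if l: "l \<in># links S" for l
        proof (cases l)
          case (Tensor p1 p2 p)
          then show ?thesis
            using isolated l out[of l p] by auto
        next
          case (Par p1 p2 p)
          then obtain L where L: "links S = {#Par p1 p2 p, Daimon ps#} + L"
            using ps l multi_member_split2'[of l "links S" "Daimon ps"] by auto
          then show ?thesis
            using irreducible(1)[OF L] Par l out[of l p] by auto
        next
          case (Daimon qs)
          then show ?thesis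
            using out[of l] l by (cases "qs = ps") auto
        qed simp
        have "0 < daimons (links S - {#Daimon ps#})"
          using two arg_cong[OF insert_DiffM[OF ps], of daimons] by simp
        then obtain qs where qs: "Daimon qs \<in># links S - {#Daimon ps#}"
          unfolding daimons_pos_iff by blast
        have "disconnecting ?c (links S)"
          unfolding disconnecting_def
        proof (intro conjI allI ballI)
          fix b
          show "\<exists>rs. Daimon rs \<in># links S \<and> (\<forall>p \<in> set rs. ?c p = b)"
            using ps other[OF qs] in_diffD[OF qs]
            by (cases b) (auto intro: exI[of _ ps] exI[of _ qs])
        qed (use col two in auto)
        then show False
          using conn by blast
      qed
      then have "daimons (links S) \<le> tensors (links S)"
        using daimons_le_tensors[OF S] irreducible(2) by blast
      then show False
        using count by simp
    qed
    then have "tensors (links S) = 0"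
      using count by simp
    then have no_tensor: "Tensor p1 p2 p \<notin># links S" for p1 p2 p
      using multi_member_split[of "Tensor p1 p2 p" "links S"] by auto
    obtain d where d: "filter_mset is_daimon (links S) = {#d#}"
      using one size_1_singleton_mset unfolding daimons_def by blast
    then have "d \<in># filter_mset is_daimon (links S)"
      by simp
    then obtain ps where ps: "d = Daimon ps" "Daimon ps \<in># links S"
      by (cases d) auto
    have unique: "qs = ps" if "Daimon qs \<in># links S" for qs
    proof -
      have "Daimon qs \<in># filter_mset is_daimon (links S)"
        using that by simp
      then show ?thesis
        using d ps by simp
    qed
    have no_par: "Par p1 p2 p \<notin># links S" for p1 p2 p
    proof
      assume "Par p1 p2 p \<in># links S"
      \<comment> \<open>A par link with a label of least size: its premises have smaller labels, so
        no par link produces them and they come from the only daimon.\<close>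
      then obtain p1 p2 p where par: "Par p1 p2 p \<in># links S"
        and least: "\<And>q1 q2 q. Par q1 q2 q \<in># links S \<Longrightarrow> size (\<tau> p) \<le> size (\<tau> q)"
        using ex_has_least_nat[of "\<lambda>(p1, p2, p). Par p1 p2 p \<in># links S" "(p1, p2, p)" "\<lambda>(p1, p2, p). size (\<tau> p)"]
        by auto
      have initial: "x \<in> set ps" if x: "x \<in> {p1, p2}" for x
      proof -
        obtain k where k: "k \<in># links S" "x \<in> set (outputs k)"
          using wired_producer[OF S par, of x] x by auto
        have small: "size (\<tau> x) < size (\<tau> p)"
          using tau(1)[OF par] x by auto
        show ?thesis
        proof (cases k)
          case (Par q1 q2 q)
          then show ?thesis
            using k least[of q1 q2 q] small by simp
        next
          case (Daimon qs)
          then show ?thesis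
            using k unique by auto
        qed (use k no_tensor in auto)
      qed
      obtain L where L: "links S = {#Par p1 p2 p, Daimon ps#} + L"
        using ps(2) par multi_member_split2'[of "Par p1 p2 p" "links S" "Daimon ps"] by auto
      show False
        using irreducible(1)[OF L] initial by simp
    qed
    have "is_daimon l" if "l \<in># links S" for l
      using that no_par no_tensor \<open>cut_free S\<close> by (cases l) (auto simp: cut_free_def)
    then have L: "links S = {#Daimon ps#}"
      using d ps filter_mset_cong[OF refl, of "links S" is_daimon "\<lambda>_. True"] by simp
    have dist: "distinct ps"
      using wired_distinct_daimon[OF S ps(2)] .
    have "x \<in> set (conclusions S) \<longleftrightarrow> x \<in> set ps" for x
      using S L by (auto simp: wired_def)
    then have "mset ps = mset (conclusions S)"
      using dist S by (subst set_eq_iff_mset_eq_distinct[symmetric]) (auto simp: wired_def)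
    then have "seq \<tau> (Net {#Daimon ps#} (conclusions S))"
      using seq.permute[OF seq.daimon[OF dist]] by blast
    then show ?thesis
      using L by (cases S) simp
  qed
qed

section \<open>Switchings\<close>

primrec is_par :: "'p link \<Rightarrow> bool" where
  "is_par (Tensor p1 p2 p) = False"
| "is_par (Par p1 p2 p) = True"
| "is_par (Cut p q) = False"
| "is_par (Daimon ps) = False"

text \<open>
  A switching is encoded by the set of the premises of par links that it disconnects: such a
  description is stable under the switching steps, which change outputs but never inputs.
\<close>

definition switches :: "'p set \<Rightarrow> 'p link multiset \<Rightarrow> bool" where
  "switches K L \<longleftrightarrow>
     (\<forall>p1 p2 p. Par p1 p2 p \<in># L \<longrightarrow> (p1 \<in> K) \<noteq> (p2 \<in> K)) \<and>
     (\<forall>l \<in># L. \<not> is_par l \<longrightarrow> K \<inter> set (inputs l) = {})"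

definition descends_avoiding :: "'p set \<Rightarrow> 'p link multiset \<Rightarrow> 'p \<Rightarrow> 'p \<Rightarrow> bool" where
  "descends_avoiding K L p q \<longleftrightarrow> (\<exists>l \<in># L. p \<in> set (inputs l) - K \<and> q \<in> set (outputs l))"

text \<open>These become the conclusions of the switched net: the old ones and the premises that get
  disconnected. The set is constant along the switching.\<close>

definition roots :: "'p set \<Rightarrow> 'p net \<Rightarrow> 'p set" where
  "roots K S = set (conclusions S) \<union> {p \<in> K. 0 < in_deg (links S) p}"

text \<open>The half of the net conditions that concerns inputs. Switching steps leave the inputs of
  the remaining links alone, so it is easily preserved.\<close>

definition separated_inputs :: "'p net \<Rightarrow> bool" where
  "separated_inputs S \<longleftrightarrow>
     (\<forall>p. in_deg (links S) p \<le> 1 \<and> (p \<in> set (conclusions S) \<longrightarrow> in_deg (links S) p = 0))"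

lemma inputs_map_outputs [simp]: "inputs (map_outputs r l) = inputs l"
  and outputs_map_outputs [simp]: "outputs (map_outputs r l) = map r (outputs l)"
  and is_par_map_outputs [simp]: "is_par (map_outputs r l) = is_par l"
  by (cases l; simp)+

lemma in_deg_map_outputs [simp]: "in_deg (image_mset (map_outputs r) L) p = in_deg L p"
  by (induction L) auto

lemma switches_map_outputs [simp]: "switches K (image_mset (map_outputs r) L) = switches K L"
proof -
  have "Par p1 p2 p = map_outputs r l \<longleftrightarrow> (\<exists>q. l = Par p1 p2 q \<and> p = r q)" for p1 p2 p l
    by (cases l) auto
  then show ?thesis
    unfolding switches_def by (auto simp: image_iff) blast+
qed

text \<open>A switching step contracts the edge from \<open>kept\<close> to \<open>p\<close>, and
  \<open>r\<close> is this contraction; descent is unaffected up to \<open>r\<close>. The position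
  \<open>lost\<close> stops being a root as a consumed element of \<open>K\<close> and becomes one
  as a conclusion.\<close>

lemma switching_step_partition:
  assumes K: "switches K (add_mset (Par p1 p2 p) L)" "separated_inputs (Net (add_mset (Par p1 p2 p) L) C)"
    and kept: "kept \<in> {p1, p2} - K" and lost: "lost \<in> {p1, p2} \<inter> K"
  defines "r \<equiv> id(kept := p)"
  defines "L' \<equiv> image_mset (map_outputs r) L"
  shows "switches K L'" and "separated_inputs (Net L' (C @ [lost]))"
    and "roots K (Net L' (C @ [lost])) = roots K (Net (add_mset (Par p1 p2 p) L) C)"
    and "q \<in> roots K (Net L' (C @ [lost])) \<Longrightarrow>
      (descends_avoiding K L')\<^sup>*\<^sup>* (r x) q \<longleftrightarrow> (descends_avoiding K (add_mset (Par p1 p2 p) L))\<^sup>*\<^sup>* x q"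
proof -
  let ?L = "add_mset (Par p1 p2 p) L"
  show "switches K L'"
    using K(1) unfolding L'_def switches_map_outputs by (auto simp: switches_def)
  have deg: "in_deg ?L x \<le> 1" "x \<in> set C \<Longrightarrow> in_deg ?L x = 0" for x
    using K(2) by (auto simp: separated_inputs_def)
  have deg0: "in_deg L p1 = 0" "in_deg L p2 = 0"
    using deg(1)[of p1] deg(1)[of p2] by simp_all
  have "in_deg L x \<le> 1 \<and> (x \<in> set (C @ [lost]) \<longrightarrow> in_deg L x = 0)" for x
    using deg[of x] deg0 lost by (auto split: if_splits)
  then show "separated_inputs (Net L' (C @ [lost]))"
    by (simp add: separated_inputs_def L'_def)
  have "kept \<noteq> lost" and K12: "x \<in> {p1, p2} \<Longrightarrow> x = kept \<or> x = lost" for x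
    using kept lost K(1) by (auto simp: switches_def)
  then show roots: "roots K (Net L' (C @ [lost])) = roots K (Net ?L C)"
    using kept lost by (auto simp: roots_def L'_def)
  show "(descends_avoiding K L')\<^sup>*\<^sup>* (r x) q \<longleftrightarrow> (descends_avoiding K ?L)\<^sup>*\<^sup>* x q"
    if q: "q \<in> roots K (Net L' (C @ [lost]))"
  proof
    \<comment> \<open>\<open>kept\<close> is consumed and lies outside \<open>K\<close>, so the
      contraction moves no root.\<close>
    have "kept \<notin> roots K (Net ?L C)"
      using kept deg(2)[of kept] by (auto simp: roots_def)
    then have rq: "r q = q"
      using q roots by (auto simp: r_def)
    have up: "descends_avoiding K ?L kept p"
      using kept by (auto simp: descends_avoiding_def)
    show "(descends_avoiding K L')\<^sup>*\<^sup>* (r x) q" if "(descends_avoiding K ?L)\<^sup>*\<^sup>* x q"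
      using that
    proof (induction rule: converse_rtranclp_induct)
      case base
      then show ?case
        using rq by simp
    next
      case (step x y)
      obtain l where l: "l \<in># ?L" "x \<in> set (inputs l)" "x \<notin> K" "y \<in> set (outputs l)"
        using step.hyps(1) unfolding descends_avoiding_def by blast
      show ?case
      proof (cases "x \<in> {p1, p2}")
        case True
        then have "x = kept"
          using K12 lost l(3) by auto
        moreover have "l = Par p1 p2 p"
          using True l(1,2) deg0 in_deg_pos_iff[of L] by (metis insertE neq0_conv set_mset_add_mset_insert singletonD)
        ultimately show ?thesis
          using step.IH l(4) by (simp add: r_def split: if_splits)
      next
        case False
        then have "l \<in># L" "r x = x"
          using l kept by (auto simp: r_def)
        then have "descends_avoiding K L' (r x) (r y)"
          using l by (auto simp: descends_avoiding_def L'_def intro!: bexI[of _ l])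
        then show ?thesis
          using step.IH by (rule converse_rtranclp_into_rtranclp)
      qed
    qed
    have r: "(descends_avoiding K ?L)\<^sup>*\<^sup>* y (r y)" for y
      using up by (auto simp: r_def)
    show "(descends_avoiding K ?L)\<^sup>*\<^sup>* x q" if "(descends_avoiding K L')\<^sup>*\<^sup>* (r x) q"
    proof -
      have "(descends_avoiding K ?L)\<^sup>*\<^sup>* x' q" if "(descends_avoiding K L')\<^sup>*\<^sup>* x' q" for x'
        using that
      proof (induction rule: converse_rtranclp_induct)
        case (step x y)
        then obtain l z where l: "l \<in># L" "x \<in> set (inputs l)" "x \<notin> K" "z \<in> set (outputs l)" "y = r z"
          by (auto simp: descends_avoiding_def L'_def)
        then have "descends_avoiding K ?L x z"
          by (auto simp: descends_avoiding_def)
        then show ?case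
          using r[of z] step.IH l(5) by (meson converse_rtranclp_into_rtranclp rtranclp_trans)
      qed simp
      then show ?thesis
        using r[of x] that by (meson rtranclp_trans)
    qed
  qed
qed

text \<open>The steps prescribed by \<open>K\<close> can be taken in any order. The tracking map
  \<open>\<iota>\<close> is arbitrary because each step composes its contraction onto it.\<close>

lemma switching_exists:
  assumes "switches K L" "separated_inputs (Net L C)"
  shows "\<exists>L' C' \<iota>'. switching_step\<^sup>*\<^sup>* (Net L C, \<iota>) (Net L' C', \<iota>') \<and> (\<forall>l \<in># L'. \<not> is_par l) \<and>
    set C' = roots K (Net L C) \<and>
    (\<forall>x. \<forall>q \<in> set C'. (descends (Net L' C'))\<^sup>*\<^sup>* (\<iota>' x) q \<longleftrightarrow> (descends_avoiding K L)\<^sup>*\<^sup>* (\<iota> x) q)"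
  using assms
proof (induction "size L" arbitrary: L C \<iota> rule: less_induct)
  case less
  show ?case
  proof (cases "\<exists>l \<in># L. is_par l")
    case False
    then have no_input: "K \<inter> set (inputs l) = {}" if "l \<in># L" for l
      using less.prems(1) that by (auto simp: switches_def)
    then have "descends (Net L C) = descends_avoiding K L"
      by (auto simp: fun_eq_iff descends_def descends_avoiding_def)
    moreover have "roots K (Net L C) = set C"
      using no_input in_deg_pos_iff[of L] by (auto simp: roots_def)
    ultimately show ?thesis
      using False by (intro exI[of _ L] exI[of _ C] exI[of _ \<iota>]) auto
  next
    case True
    then obtain l where "l \<in># L" "is_par l"
      by blast
    then obtain p1 p2 p where "Par p1 p2 p \<in># L"
      by (cases l) auto
    then obtain M where L: "L = add_mset (Par p1 p2 p) M"
      by (blast dest: multi_member_split)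
    have "(p1 \<in> K) \<noteq> (p2 \<in> K)"
      using less.prems(1) L by (auto simp: switches_def)
    then obtain kept lost where "kept \<notin> K" "lost \<in> K"
      and kl: "(kept = p1 \<and> lost = p2) \<or> (kept = p2 \<and> lost = p1)"
      by blast
    then have K: "kept \<in> {p1, p2} - K" "lost \<in> {p1, p2} \<inter> K"
      by auto
    let ?r = "id(kept := p)"
    let ?M = "image_mset (map_outputs ?r) M"
    note P = switching_step_partition[OF less.prems[unfolded L] K]
    have step: "switching_step (Net L C, \<iota>) (Net ?M (C @ [lost]), ?r \<circ> \<iota>)"
      using kl by (elim disjE conjE)
        (simp_all only: L switching_step.left[OF refl] switching_step.right[OF refl])
    obtain L' C' \<iota>' where R: "switching_step\<^sup>*\<^sup>* (Net ?M (C @ [lost]), ?r \<circ> \<iota>) (Net L' C', \<iota>')"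
      "\<forall>l \<in># L'. \<not> is_par l" "set C' = roots K (Net ?M (C @ [lost]))"
      "\<forall>x. \<forall>q \<in> set C'. (descends (Net L' C'))\<^sup>*\<^sup>* (\<iota>' x) q \<longleftrightarrow> (descends_avoiding K ?M)\<^sup>*\<^sup>* ((?r \<circ> \<iota>) x) q"
      using less.hyps[of ?M "C @ [lost]" "?r \<circ> \<iota>"] P(1,2) L by auto
    show ?thesis
      using converse_rtranclp_into_rtranclp[OF step R(1)] R(2-4) P(3) P(4) L
      by (intro exI[of _ L'] exI[of _ C'] exI[of _ \<iota>']) auto
  qed
qed

lemma switching_of_exists:
  assumes "switches K (links S)" "separated_inputs S"
  shows "\<exists>\<sigma>. switching_of S \<sigma> \<and> switching_partition S \<sigma> =
    {{p \<in> initial_positions S. (descends_avoiding K (links S))\<^sup>*\<^sup>* p q} | q. q \<in> roots K S}"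
proof -
  obtain L' C' \<iota>' where R: "switching_step\<^sup>*\<^sup>* (S, id) (Net L' C', \<iota>')" "\<forall>l \<in># L'. \<not> is_par l"
    "set C' = roots K S"
    "\<forall>x. \<forall>q \<in> set C'. (descends (Net L' C'))\<^sup>*\<^sup>* (\<iota>' x) q \<longleftrightarrow> (descends_avoiding K (links S))\<^sup>*\<^sup>* x q"
    using switching_exists[of K "links S" "conclusions S" id] assms by auto
  have "\<nexists>\<sigma>. switching_step (Net L' C', \<iota>') \<sigma>"
    using R(2) by (auto elim!: switching_step.cases)
  then have "switching_of S (Net L' C', \<iota>')"
    using R(1) by (simp add: switching_of_def)
  moreover have "(\<lambda>q. {p \<in> initial_positions S. (descends (Net L' C'))\<^sup>*\<^sup>* (\<iota>' p) q}) ` set C' =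
      (\<lambda>q. {p \<in> initial_positions S. (descends_avoiding K (links S))\<^sup>*\<^sup>* p q}) ` roots K S"
    using R(3,4) by (intro image_cong) auto
  then have "switching_partition S (Net L' C', \<iota>') =
      {{p \<in> initial_positions S. (descends_avoiding K (links S))\<^sup>*\<^sup>* p q} | q. q \<in> roots K S}"
    unfolding switching_partition_def Setcompr_eq_image fst_conv snd_conv net.sel .
  ultimately show ?thesis
    by blast
qed

section \<open>The tests of a formula\<close>

text \<open>Addresses are read from a subformula down to the whole formula, so that \<open>tl\<close> leads to the parent.\<close>

primrec subformula_at :: "'x formula \<Rightarrow> bool list \<Rightarrow> 'x formula option" where
  "subformula_at A [] = Some A"
| "subformula_at A (b # a) =
     (case subformula_at A a of
        Some (FPar B C) \<Rightarrow> Some (if b then C else B)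
      | Some (FTensor B C) \<Rightarrow> Some (if b then C else B)
      | _ \<Rightarrow> None)"

definition par_addresses :: "'x formula \<Rightarrow> bool list set" where
  "par_addresses A = {a. \<exists>B C. subformula_at A a = Some (FPar B C)}"

definition tensor_addresses :: "'x formula \<Rightarrow> bool list set" where
  "tensor_addresses A = {a. \<exists>B C. subformula_at A a = Some (FTensor B C)}"

definition leaf_addresses :: "'x formula \<Rightarrow> bool list set" where
  "leaf_addresses A = {a. \<exists>X. subformula_at A a = Some (Var X)}"

lemmas addresses_defs = par_addresses_def tensor_addresses_def leaf_addresses_def

section \<open>Addresses under relabelling of atoms and under duality\<close>

lemma subformula_at_map: "subformula_at (map_formula f A) a = map_option (map_formula f) (subformula_at A a)"
  by (induction a) (auto split: option.splits formula.splits)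

lemma subformula_at_dual: "subformula_at (dual perp A) a = map_option (dual perp) (subformula_at A a)"
  by (induction a) (auto split: option.splits formula.splits)

lemma addresses_map [simp]:
  "par_addresses (map_formula f A) = par_addresses A"
  "tensor_addresses (map_formula f A) = tensor_addresses A"
  "leaf_addresses (map_formula f A) = leaf_addresses A"
proof -
  have "map_formula f B = FPar C D \<longleftrightarrow> (\<exists>C' D'. B = FPar C' D' \<and> C = map_formula f C' \<and> D = map_formula f D')"
    "map_formula f B = FTensor C D \<longleftrightarrow> (\<exists>C' D'. B = FTensor C' D' \<and> C = map_formula f C' \<and> D = map_formula f D')"
    "map_formula f B = Var y \<longleftrightarrow> (\<exists>x. B = Var x \<and> y = f x)" for B C D y
    by (cases B; auto)+
  then show "par_addresses (map_formula f A) = par_addresses A"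
    "tensor_addresses (map_formula f A) = tensor_addresses A"
    "leaf_addresses (map_formula f A) = leaf_addresses A"
    by (auto simp: addresses_defs subformula_at_map)
qed

lemma addresses_dual [simp]:
  "par_addresses (dual perp A) = tensor_addresses A"
  "tensor_addresses (dual perp A) = par_addresses A"
  "leaf_addresses (dual perp A) = leaf_addresses A"
proof -
  have "dual perp B = FPar C D \<longleftrightarrow> (\<exists>C' D'. B = FTensor C' D' \<and> C = dual perp C' \<and> D = dual perp D')"
    "dual perp B = FTensor C D \<longleftrightarrow> (\<exists>C' D'. B = FPar C' D' \<and> C = dual perp C' \<and> D = dual perp D')"
    "dual perp B = Var y \<longleftrightarrow> (\<exists>x. B = Var x \<and> y = perp x)" for B C D y
    by (cases B; auto)+
  then show "par_addresses (dual perp A) = tensor_addresses A"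
    "tensor_addresses (dual perp A) = par_addresses A"
    "leaf_addresses (dual perp A) = leaf_addresses A"
    by (auto simp: addresses_defs subformula_at_dual)
qed

lemma subformula_at_size: "subformula_at A a = Some B \<Longrightarrow> size B + length a \<le> size A"
proof (induction a arbitrary: B)
  case (Cons b a)
  then obtain C where "subformula_at A a = Some C" "size B + 1 \<le> size C"
    by (auto split: option.splits formula.splits if_splits)
  then show ?case
    using Cons.IH[of C] by simp
qed simp

lemma finite_addresses: "finite {a. subformula_at A a \<noteq> None}"
proof (rule finite_subset)
  show "{a. subformula_at A a \<noteq> None} \<subseteq> {a. set a \<subseteq> UNIV \<and> length a \<le> size A}"
    using subformula_at_size by fastforce
  show "finite {a. set a \<subseteq> (UNIV :: bool set) \<and> length a \<le> size A}"
    by (rule finite_lists_length_le) simp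
qed

lemma finite_addresses' [simp]:
  "finite (par_addresses A)" "finite (tensor_addresses A)" "finite (leaf_addresses A)"
  by (rule finite_subset[OF _ finite_addresses[of A]]; auto simp: addresses_defs)+

lemma addresses_disjoint:
  "a \<in> par_addresses A \<Longrightarrow> a \<notin> tensor_addresses A" "a \<in> par_addresses A \<Longrightarrow> a \<notin> leaf_addresses A"
  "a \<in> tensor_addresses A \<Longrightarrow> a \<notin> leaf_addresses A"
  by (auto simp: addresses_defs)

lemma subformula_at_defined_iff:
  "subformula_at A a \<noteq> None \<longleftrightarrow> a \<in> par_addresses A \<or> a \<in> tensor_addresses A \<or> a \<in> leaf_addresses A"
proof -
  have "subformula_at A a \<noteq> None \<longleftrightarrow> (\<exists>B. subformula_at A a = Some B)"
    by auto
  then show ?thesis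
    unfolding addresses_defs mem_Collect_eq by (metis formula.exhaust)
qed

lemma subformula_at_Cons_defined_iff:
  "subformula_at A (b # a) \<noteq> None \<longleftrightarrow> a \<in> par_addresses A \<or> a \<in> tensor_addresses A"
  by (auto simp: addresses_defs split: option.splits formula.splits)

section \<open>Forests inside a syntax tree and the nets they define\<close>

text \<open>When the edges above the addresses in \<open>K\<close> are cut, \<open>root K a\<close> is the root of the tree containing \<open>a\<close>.\<close>

primrec root :: "bool list set \<Rightarrow> bool list \<Rightarrow> bool list" where
  "root K [] = []"
| "root K (b # a) = (if b # a \<in> K then b # a else root K a)"

lemma root_in: "root K a \<in> insert [] K"
  by (induction a) auto

definition block :: "'x formula \<Rightarrow> bool list set \<Rightarrow> bool list \<Rightarrow> nat list" where
  "block A K r = sorted_list_of_set (to_nat ` {a \<in> leaf_addresses A. root K a = r})"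

text \<open>The syntax tree of \<open>A\<close> as a net, with coded addresses as positions and a
  daimon for each tree of the forest. \<open>K = {}\<close> gives a single daimon and serves as the
  net to be switched; the tests take for \<open>K\<close> the premises that the switching
  disconnects.\<close>

definition formula_net :: "'x formula \<Rightarrow> bool list set \<Rightarrow> nat net" where
  "formula_net A K = Net
     (image_mset (\<lambda>a. Par (to_nat (False # a)) (to_nat (True # a)) (to_nat a)) (mset_set (par_addresses A)) +
      image_mset (\<lambda>a. Tensor (to_nat (False # a)) (to_nat (True # a)) (to_nat a)) (mset_set (tensor_addresses A)) +
      image_mset (\<lambda>r. Daimon (block A K r)) (mset_set (insert [] K)))
     [to_nat ([] :: bool list)]"

lemma formula_net_cong:
  assumes "par_addresses A = par_addresses B" "tensor_addresses A = tensor_addresses B"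
    "leaf_addresses A = leaf_addresses B"
  shows "formula_net A K = formula_net B K"
  by (simp add: formula_net_def block_def assms)

lemma set_block [simp]: "set (block A K r) = to_nat ` {a \<in> leaf_addresses A. root K a = r}"
  and distinct_block [simp]: "distinct (block A K r)"
  by (simp_all add: block_def)

lemma conclusions_formula_net [simp]: "conclusions (formula_net A K) = [to_nat ([] :: bool list)]"
  by (simp add: formula_net_def)

lemma in_formula_net:
  assumes "finite K"
  shows "Par p1 p2 p \<in># links (formula_net A K) \<longleftrightarrow>
      (\<exists>a \<in> par_addresses A. p1 = to_nat (False # a) \<and> p2 = to_nat (True # a) \<and> p = to_nat a)"
    and "Tensor p1 p2 p \<in># links (formula_net A K) \<longleftrightarrow>
      (\<exists>a \<in> tensor_addresses A. p1 = to_nat (False # a) \<and> p2 = to_nat (True # a) \<and> p = to_nat a)"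
    and "Cut p1 p2 \<notin># links (formula_net A K)"
    and "Daimon ps \<in># links (formula_net A K) \<longleftrightarrow> (\<exists>r \<in> insert [] K. ps = block A K r)"
  using assms by (auto simp: formula_net_def)

lemma deg_image_mset_set:
  assumes "finite X"
  shows "in_deg (image_mset f (mset_set X)) p = card {a \<in> X. p \<in> set (inputs (f a))}"
    and "out_deg (image_mset f (mset_set X)) p = card {a \<in> X. p \<in> set (outputs (f a))}"
  using assms by (simp_all add: in_deg_def out_deg_def filter_mset_image_mset filter_mset_mset_set)

text \<open>Degrees are at most one since a nonempty address has one parent, its \<open>tl\<close>,
  and a leaf lies in one block only, that of its \<open>root\<close>.\<close>

lemma deg_formula_net:
  fixes A :: "'x formula"
  assumes "finite K"
  shows "in_deg (links (formula_net A K)) p =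
      (if p \<in> to_nat ` {a. subformula_at A a \<noteq> None \<and> a \<noteq> []} then 1 else 0)"
    and "out_deg (links (formula_net A K)) p = (if p \<in> to_nat ` {a. subformula_at A a \<noteq> None} then 1 else 0)"
proof -
  have card_if: "card {x. x = c \<and> P} = (if P then 1 else 0)" for c :: "bool list" and P
    by auto
  have pre: "{a \<in> X. p = to_nat (False # a) \<or> p = to_nat (True # a)} =
      (if \<exists>b c. p = to_nat (b # c) \<and> c \<in> X then {tl (from_nat p)} else {})" for X
  proof (cases "\<exists>b c. p = to_nat (b # c) \<and> c \<in> X")
    case True
    then obtain b c where "p = to_nat (b # c)" "c \<in> X" by blast
    then show ?thesis by (cases b) auto
  qed auto
  have 1: "in_deg (links (formula_net A K)) p =
      card {a \<in> par_addresses A. p = to_nat (False # a) \<or> p = to_nat (True # a)} +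
      card {a \<in> tensor_addresses A. p = to_nat (False # a) \<or> p = to_nat (True # a)}"
    using assms by (simp add: formula_net_def deg_image_mset_set del: mset_set.insert)
  have "p \<in> to_nat ` {a. subformula_at A a \<noteq> None \<and> a \<noteq> []} \<longleftrightarrow>
      (\<exists>b c. p = to_nat (b # c) \<and> subformula_at A (b # c) \<noteq> None)"
    by (auto simp: image_iff neq_Nil_conv simp del: subformula_at.simps)
  then have 2: "p \<in> to_nat ` {a. subformula_at A a \<noteq> None \<and> a \<noteq> []} \<longleftrightarrow>
      (\<exists>b c. p = to_nat (b # c) \<and> c \<in> par_addresses A) \<or> (\<exists>b c. p = to_nat (b # c) \<and> c \<in> tensor_addresses A)"
    unfolding subformula_at_Cons_defined_iff by blast
  show "in_deg (links (formula_net A K)) p =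
      (if p \<in> to_nat ` {a. subformula_at A a \<noteq> None \<and> a \<noteq> []} then 1 else 0)"
    unfolding 1 2 pre using addresses_disjoint(1)[of _ A] by auto
  have post: "{a \<in> X. p = to_nat a} = (if p \<in> to_nat ` X then {from_nat p} else {})" for X :: "bool list set"
    by auto
  have blk: "{r \<in> insert [] K. p \<in> to_nat ` {a \<in> leaf_addresses A. root K a = r}} =
      (if p \<in> to_nat ` leaf_addresses A then {root K (from_nat p)} else {})"
    using root_in[of K] by auto
  have 3: "out_deg (links (formula_net A K)) p =
      card {a \<in> par_addresses A. p = to_nat a} + card {a \<in> tensor_addresses A. p = to_nat a} +
      card {r \<in> insert [] K. p \<in> to_nat ` {a \<in> leaf_addresses A. root K a = r}}"
    using assms by (simp add: formula_net_def deg_image_mset_set add: singleton_iff del: mset_set.insert insert_iff)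
  have 4: "p \<in> to_nat ` {a. subformula_at A a \<noteq> None} \<longleftrightarrow>
      p \<in> to_nat ` par_addresses A \<or> p \<in> to_nat ` tensor_addresses A \<or> p \<in> to_nat ` leaf_addresses A"
    unfolding subformula_at_defined_iff by auto
  show "out_deg (links (formula_net A K)) p = (if p \<in> to_nat ` {a. subformula_at A a \<noteq> None} then 1 else 0)"
    unfolding 3 4 post blk using addresses_disjoint[of _ A] by auto
qed

lemma is_net_formula_net:
  assumes "finite K"
  shows "is_net (formula_net A K)"
  unfolding is_net_iff wired_def
proof (intro conjI ballI allI)
  show "links (formula_net A K) \<noteq> {#}"
    using assms by (simp add: formula_net_def mset_set_empty_iff)
  show "wf_link l" if "l \<in># links (formula_net A K)" for l
    using that by (cases l) (auto simp: in_formula_net[OF assms] wf_link_def)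
  show "distinct (conclusions (formula_net A K))"
    by simp
  fix p
  show "in_deg (links (formula_net A K)) p \<le> out_deg (links (formula_net A K)) p"
    and "out_deg (links (formula_net A K)) p \<le> 1"
    and "p \<in> set (conclusions (formula_net A K)) \<longleftrightarrow>
      in_deg (links (formula_net A K)) p < out_deg (links (formula_net A K)) p"
    unfolding deg_formula_net[OF assms] by auto
qed

lemma cut_free_formula_net: "finite K \<Longrightarrow> cut_free (formula_net A K)"
  by (simp add: cut_free_def in_formula_net)

lemma formula_labelling_formula_net:
  "finite K \<Longrightarrow> formula_labelling (formula_net A K) (\<lambda>p. the (subformula_at A (from_nat p)))"
  by (auto simp: formula_labelling_def in_formula_net addresses_defs)

lemma initial_positions_formula_net:
  assumes "finite K"
  shows "initial_positions (formula_net A K) = to_nat ` leaf_addresses A"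
proof -
  have "initial_positions (formula_net A K) = (\<Union>r \<in> insert [] K. set (block A K r))"
    unfolding initial_positions_def in_formula_net(4)[OF assms] by blast
  also have "\<dots> = to_nat ` leaf_addresses A"
    unfolding set_block using root_in[of K] by fast
  finally show ?thesis .
qed

lemma atomically_testable_formula_net:
  assumes "finite K"
  shows "atomically_testable (formula_net A K) [A]"
  unfolding atomically_testable_def
proof (intro exI conjI)
  show "atomic_labelling (formula_net A K) (\<lambda>p. the (subformula_at A (from_nat p)))"
    by (auto simp: atomic_labelling_def initial_positions_formula_net[OF assms] leaf_addresses_def)
qed (use formula_labelling_formula_net[OF assms] in auto)

lemma daimon_partition_formula_net:
  "finite K \<Longrightarrow> daimon_partition (formula_net A K) =
     {to_nat ` {a \<in> leaf_addresses A. root K a = r} | r. r \<in> insert [] K}"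
  unfolding daimon_partition_def by (auto simp: in_formula_net) (metis set_block)+

lemma count_formula_net:
  assumes "finite K"
  shows "daimons (links (formula_net A K)) = card (insert [] K)"
    and "tensors (links (formula_net A K)) = card (tensor_addresses A)"
    and "cuts (links (formula_net A K)) = 0"
  using assms
  by (simp_all add: formula_net_def daimons_def tensors_def cuts_def filter_mset_image_mset filter_mset_mset_set
      del: mset_set.insert card_insert_disjoint)

text \<open>Duality exchanges par and tensor links, and \<open>located\<close> does not distinguish
  them. Hence natural indices agree between the nets of a formula and of its dual.\<close>

lemma located_formula_net:
  assumes "finite K" "finite K'"
  shows "located (formula_net A K) i w p \<Longrightarrow> located (formula_net (dual perp A) K') i w p"
proof (induction rule: located.induct)
  case (root i)
  then show ?case
    using located.root[of i "formula_net (dual perp A) K'"] by simp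
next
  case (left i w p p1 p2)
  then have "Par p1 p2 p \<in># links (formula_net (dual perp A) K') \<or> Tensor p1 p2 p \<in># links (formula_net (dual perp A) K')"
    by (auto simp: in_formula_net assms)
  with left.IH show ?case
    by (rule located.left)
next
  case (right i w p p1 p2)
  then have "Par p1 p2 p \<in># links (formula_net (dual perp A) K') \<or> Tensor p1 p2 p \<in># links (formula_net (dual perp A) K')"
    by (auto simp: in_formula_net assms)
  with right.IH show ?case
    by (rule located.right)
qed

lemma natural_index_formula_net:
  assumes "finite K" "finite K'"
  shows "natural_index (formula_net (dual perp A) K) = natural_index (formula_net A K')"
proof -
  \<comment> \<open>The net depends on \<open>A\<close> through its addresses only, which dualizing
    twice restores; this yields the converse direction of
    \<open>located_formula_net\<close>.\<close>
  have "formula_net (dual perp (dual perp A)) K' = formula_net A K'"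
    by (rule formula_net_cong) simp_all
  then have "located (formula_net (dual perp A) K) i w p = located (formula_net A K') i w p" for i w p
    using located_formula_net[OF assms, of "dual perp A"] located_formula_net[OF assms(2,1), of A] by metis
  then have "located (formula_net (dual perp A) K) = located (formula_net A K')"
    by (simp add: fun_eq_iff)
  then show ?thesis
    by (simp add: natural_index_def before_def initial_positions_formula_net assms fun_eq_iff)
qed

text \<open>Descent drops the head of an address and stops at elements of \<open>K\<close>, just as
  \<open>root\<close> recurses. Restricting \<open>q\<close> to roots excludes the addresses that
  are merely passed on the way.\<close>

lemma descends_formula_net:
  assumes q: "q \<in> insert [] K" and a: "subformula_at A a \<noteq> None"
  shows "(descends_avoiding (to_nat ` K) (links (formula_net A {})))\<^sup>*\<^sup>* (to_nat a) (to_nat q) \<longleftrightarrow> root K a = q"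
    (is "?D\<^sup>*\<^sup>* _ _ \<longleftrightarrow> _")
proof -
  have D: "?D (to_nat a) p \<longleftrightarrow> (\<exists>b c. a = b # c \<and> a \<notin> K \<and> p = to_nat c)"
    if "subformula_at A a \<noteq> None" for a p
  proof
    assume "?D (to_nat a) p"
    then obtain l where "l \<in># links (formula_net A {})" "to_nat a \<in> set (inputs l)" "a \<notin> K" "p \<in> set (outputs l)"
      by (auto simp: descends_avoiding_def)
    then show "\<exists>b c. a = b # c \<and> a \<notin> K \<and> p = to_nat c"
      by (cases l) (auto simp: in_formula_net)
  next
    assume "\<exists>b c. a = b # c \<and> a \<notin> K \<and> p = to_nat c"
    then obtain b c where c: "a = b # c" "a \<notin> K" "p = to_nat c"
      by blast
    let ?P = "Par (to_nat (False # c)) (to_nat (True # c)) (to_nat c)"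
    let ?T = "Tensor (to_nat (False # c)) (to_nat (True # c)) (to_nat c)"
    have "?P \<in># links (formula_net A {}) \<or> ?T \<in># links (formula_net A {})"
      using that c(1) subformula_at_Cons_defined_iff[of A b c] by (auto simp: in_formula_net)
    moreover have "to_nat a \<in> set (inputs ?P) - to_nat ` K" "to_nat a \<in> set (inputs ?T) - to_nat ` K"
      using c by (cases b; auto)+
    ultimately show "?D (to_nat a) p"
      using c(3) unfolding descends_avoiding_def by fastforce
  qed
  show ?thesis
    using a
  proof (induction a)
    case Nil
    have "?D\<^sup>*\<^sup>* (to_nat ([] :: bool list)) p \<longleftrightarrow> p = to_nat ([] :: bool list)" for p
      using D[of "[]"] by (auto elim: converse_rtranclpE)
    then show ?case
      by auto
  next
    case (Cons b a)
    have def: "subformula_at A a \<noteq> None"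
      using Cons.prems by (auto split: option.splits)
    show ?case
    proof (cases "b # a \<in> K")
      case True
      then have "?D\<^sup>*\<^sup>* (to_nat (b # a)) p \<longleftrightarrow> p = to_nat (b # a)" for p
        using D[OF Cons.prems] by (auto elim: converse_rtranclpE)
      then show ?thesis
        using True by auto
    next
      case False
      then have "?D (to_nat (b # a)) p \<longleftrightarrow> p = to_nat a" for p
        using D[OF Cons.prems] by auto
      moreover have "q \<noteq> b # a"
        using False q by auto
      ultimately have "?D\<^sup>*\<^sup>* (to_nat (b # a)) (to_nat q) \<longleftrightarrow> ?D\<^sup>*\<^sup>* (to_nat a) (to_nat q)"
        by (metis converse_rtranclpE converse_rtranclp_into_rtranclp to_nat_split)
      then show ?thesis
        using Cons.IH[OF def] False by simp
    qed
  qed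
qed

text \<open>The witness for \<open>tests\<close> is the one-daimon net of \<open>A\<close>, switched
  so as to disconnect the premise in direction \<open>s a\<close> of each par at \<open>a\<close>.
  The trees of this switching have the same leaves as the blocks of the test, and the natural
  indices agree.\<close>

lemma formula_net_in_tests:
  assumes K: "K = (\<lambda>a. s a # a) ` par_addresses A"
  shows "formula_net (dual perp A) K \<in> tests perp A"
proof -
  have fin: "finite K"
    by (simp add: K)
  let ?S = "formula_net A {}"
  have "switches (to_nat ` K) (links ?S)"
    unfolding switches_def
  proof (intro conjI allI impI ballI)
    show "(p1 \<in> to_nat ` K) \<noteq> (p2 \<in> to_nat ` K)" if "Par p1 p2 p \<in># links ?S" for p1 p2 p
      using that by (auto simp: in_formula_net K)
    show "to_nat ` K \<inter> set (inputs l) = {}" if "l \<in># links ?S" "\<not> is_par l" for l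
      using that addresses_disjoint(1)[of _ A] by (cases l) (auto simp: in_formula_net K)
  qed
  moreover have "separated_inputs ?S"
    by (auto simp: separated_inputs_def deg_formula_net)
  ultimately obtain \<sigma> where \<sigma>: "switching_of ?S \<sigma>" "switching_partition ?S \<sigma> =
      {{p \<in> initial_positions ?S. (descends_avoiding (to_nat ` K) (links ?S))\<^sup>*\<^sup>* p q} | q. q \<in> roots (to_nat ` K) ?S}"
    using switching_of_exists by blast
  have K_defined: "subformula_at A a \<noteq> None \<and> a \<noteq> []" if "a \<in> K" for a
    using that subformula_at_Cons_defined_iff[of A] by (auto simp: K simp del: subformula_at.simps)
  have roots: "roots (to_nat ` K) ?S = to_nat ` insert [] K"
    using K_defined by (auto simp: roots_def deg_formula_net)
  have "{p \<in> initial_positions ?S. (descends_avoiding (to_nat ` K) (links ?S))\<^sup>*\<^sup>* p (to_nat r)} =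
      to_nat ` {a \<in> leaf_addresses A. root K a = r}" if "r \<in> insert [] K" for r
  proof -
    have "subformula_at A a \<noteq> None" if "a \<in> leaf_addresses A" for a
      using that by (auto simp: leaf_addresses_def)
    then show ?thesis
      using descends_formula_net[OF that] by (auto simp: initial_positions_formula_net)
  qed
  then have "switching_partition ?S \<sigma> = daimon_partition (formula_net (dual perp A) K)"
    unfolding \<sigma>(2) roots daimon_partition_formula_net[OF fin] Setcompr_eq_image image_image addresses_dual
    by (intro image_cong) auto
  then have "natural_partition (formula_net (dual perp A) K) (daimon_partition (formula_net (dual perp A) K)) =
      natural_partition ?S (switching_partition ?S \<sigma>)"
    using natural_index_formula_net[OF fin finite.emptyI, of perp A] by (simp add: natural_partition_def)
  then have "\<exists>(S :: nat net) \<sigma>. is_net S \<and> cut_free S \<and> atomically_testable S [A] \<and> switching_of S \<sigma> \<and>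
      natural_partition (formula_net (dual perp A) K) (daimon_partition (formula_net (dual perp A) K)) =
        natural_partition S (switching_partition S \<sigma>)"
    using \<sigma>(1) is_net_formula_net[OF finite.emptyI] cut_free_formula_net[OF finite.emptyI]
      atomically_testable_formula_net[OF finite.emptyI] by blast
  then show ?thesis
    using is_net_formula_net[OF fin] cut_free_formula_net[OF fin] atomically_testable_formula_net[OF fin]
    unfolding tests_def by blast
qed

section \<open>Coloured interactions\<close>

lemma dual_dual: "(\<And>x. perp (perp x) = x) \<Longrightarrow> dual perp (dual perp A) = A"
  by (induction A) auto

text \<open>The typing discipline of the interaction; with \<open>id\<close> as the involution on
  atoms, a cut passes colours on unchanged.\<close>

primrec link_typed :: "('p \<Rightarrow> bool formula) \<Rightarrow> 'p link \<Rightarrow> bool" where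
  "link_typed \<tau> (Tensor p1 p2 p) \<longleftrightarrow> \<tau> p = FTensor (\<tau> p1) (\<tau> p2)"
| "link_typed \<tau> (Par p1 p2 p) \<longleftrightarrow> \<tau> p = FPar (\<tau> p1) (\<tau> p2)"
| "link_typed \<tau> (Cut p q) \<longleftrightarrow> \<tau> q = dual id (\<tau> p)"
| "link_typed \<tau> (Daimon ps) \<longleftrightarrow> (\<exists>b. \<forall>p \<in> set ps. \<tau> p = Var b)"

text \<open>
  A closed net that reduces to a single daimon without outputs is neither of the wrong Euler
  characteristic nor disconnected by a colouring; both defects are invariant under reduction.
\<close>

definition defective :: "('p \<Rightarrow> bool formula) \<Rightarrow> 'p link multiset \<Rightarrow> bool" where
  "defective \<tau> L \<longleftrightarrow>
     daimons L \<noteq> cuts L + tensors L + 1 \<or>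
     2 \<le> daimons L \<and> (\<forall>b. \<exists>ps. Daimon ps \<in># L \<and> (\<forall>p \<in> set ps. \<tau> p = Var b))"

definition closed_typed :: "('p \<Rightarrow> bool formula) \<Rightarrow> 'p link multiset \<Rightarrow> bool" where
  "closed_typed \<tau> L \<longleftrightarrow>
     L \<noteq> {#} \<and> (\<forall>l \<in># L. wf_link l \<and> link_typed \<tau> l) \<and>
     (\<forall>p. in_deg L p = out_deg L p \<and> out_deg L p \<le> 1)"

text \<open>In the count, a tensor link is traded for an additional cut. Duality of the labels of
  \<open>p\<close> and \<open>q\<close> splits into duality for the two pairs of premises.\<close>

lemma cut_step_multiplicative_invariant:
  assumes inv: "closed_typed \<tau> ({#Par p1 p2 p, c, Tensor q1 q2 q#} + L)"
    "defective \<tau> ({#Par p1 p2 p, c, Tensor q1 q2 q#} + L)"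
    and c: "c \<in> {Cut p q, Cut q p}"
  shows "closed_typed \<tau> ({#Cut p1 q1, Cut p2 q2#} + L)" "defective \<tau> ({#Cut p1 q1, Cut p2 q2#} + L)"
proof -
  let ?N = "{#Par p1 p2 p, c, Tensor q1 q2 q#} + L" and ?N' = "{#Cut p1 q1, Cut p2 q2#} + L"
  have c_io: "set (inputs c) = {p, q}" "outputs c = []" "is_cut c" "\<not> is_daimon c" "\<not> is_tensor c"
    "\<And>ps. Daimon ps \<noteq> c"
    using c by auto
  have deg: "in_deg ?N x = out_deg ?N x" "out_deg ?N x \<le> 1" for x
    using inv(1) unfolding closed_typed_def by blast+
  have typed: "link_typed \<tau> (Par p1 p2 p)" "link_typed \<tau> c" "link_typed \<tau> (Tensor q1 q2 q)"
    "\<And>l. l \<in># L \<Longrightarrow> wf_link l \<and> link_typed \<tau> l"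
    using inv(1) unfolding closed_typed_def by auto
  have dual_id: "\<tau> q = dual id (\<tau> p)"
    using c typed(2) dual_dual[of id "\<tau> q"] by auto
  \<comment> \<open>Premises are consumed only once, so those of the par link differ from those of
    the tensor link and the new cuts are well formed.\<close>
  have inp: "x \<in> {p1, p2} \<Longrightarrow> x \<notin> {q1, q2}" for x
    using deg(1,2)[of x] c_io by (auto split: if_splits)
  have p12: "p1 \<noteq> p2" "q1 \<noteq> q2"
    using inv(1) by (auto simp: closed_typed_def wf_link_def)
  have "in_deg ?N' x = out_deg ?N' x \<and> out_deg ?N' x \<le> 1" for x
    using deg(1,2)[of x] c_io inp[of x] p12 by (auto split: if_splits)
  moreover have "wf_link (Cut p1 q1)" "wf_link (Cut p2 q2)"
    using inp by (auto simp: wf_link_def)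
  moreover have "link_typed \<tau> (Cut p1 q1)" "link_typed \<tau> (Cut p2 q2)"
    using typed(1,3) dual_id by auto
  ultimately show "closed_typed \<tau> ?N'"
    using typed(4) by (auto simp: closed_typed_def simp del: link_typed.simps)
  show "defective \<tau> ?N'"
    using inv(2) c_io by (auto simp: defective_def)
qed

text \<open>The count loses one daimon and one cut. The cut forces both daimons to have the same
  colour, which the merged daimon keeps; if both colours were present, a daimon of the other colour
  survives in \<open>L\<close>.\<close>

lemma cut_step_daimon_invariant:
  assumes inv: "closed_typed \<tau> ({#Daimon (ps @ p # ps'), c, Daimon (qs @ q # qs')#} + L)"
    "defective \<tau> ({#Daimon (ps @ p # ps'), c, Daimon (qs @ q # qs')#} + L)"
    and c: "c \<in> {Cut p q, Cut q p}"
  shows "closed_typed \<tau> ({#Daimon (ps @ ps' @ qs @ qs')#} + L)"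
    "defective \<tau> ({#Daimon (ps @ ps' @ qs @ qs')#} + L)"
proof -
  let ?D = "Daimon (ps @ p # ps')" and ?E = "Daimon (qs @ q # qs')" and ?F = "Daimon (ps @ ps' @ qs @ qs')"
  let ?N = "{#?D, c, ?E#} + L" and ?N' = "{#?F#} + L"
  have c_io: "set (inputs c) = {p, q}" "outputs c = []" "is_cut c" "\<not> is_daimon c" "\<not> is_tensor c"
    "\<And>ps. Daimon ps \<noteq> c"
    using c by auto
  have deg: "in_deg ?N x = out_deg ?N x" "out_deg ?N x \<le> 1" for x
    using inv(1) unfolding closed_typed_def by blast+
  have typed: "link_typed \<tau> ?D" "link_typed \<tau> c" "link_typed \<tau> ?E"
    "\<And>l. l \<in># L \<Longrightarrow> wf_link l \<and> link_typed \<tau> l"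
    using inv(1) unfolding closed_typed_def by auto
  have dual_id: "\<tau> q = dual id (\<tau> p)"
    using c typed(2) dual_dual[of id "\<tau> q"] by auto
  have dist: "distinct (ps @ p # ps')" "distinct (qs @ q # qs')"
    using inv(1) by (auto simp: closed_typed_def wf_link_def)
  have disj: "set (ps @ p # ps') \<inter> set (qs @ q # qs') = {}"
  proof (rule equals0I)
    fix x assume "x \<in> set (ps @ p # ps') \<inter> set (qs @ q # qs')"
    then show False
      using deg(2)[of x] by (auto split: if_splits)
  qed
  have "in_deg ?N' x = out_deg ?N' x \<and> out_deg ?N' x \<le> 1" for x
    using deg(1,2)[of x] c_io disj dist by (auto split: if_splits)
  moreover have "wf_link ?F"
    using dist disj by (auto simp: wf_link_def)
  moreover obtain b where b: "\<forall>x \<in> set (ps @ p # ps') \<union> set (qs @ q # qs'). \<tau> x = Var b"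
  proof -
    obtain b b' where "\<forall>x \<in> set (ps @ p # ps'). \<tau> x = Var b" "\<forall>x \<in> set (qs @ q # qs'). \<tau> x = Var b'"
      using typed(1,3) by auto
    then show thesis
      using dual_id by (intro that[of b]) auto
  qed
  then have "link_typed \<tau> ?F"
    by auto
  ultimately show "closed_typed \<tau> ?N'"
    using typed(4) by (auto simp: closed_typed_def simp del: link_typed.simps)
  consider "daimons ?N \<noteq> cuts ?N + tensors ?N + 1"
    | "\<And>b. \<exists>rs. Daimon rs \<in># ?N \<and> (\<forall>x \<in> set rs. \<tau> x = Var b)"
    using inv(2) unfolding defective_def by blast
  then show "defective \<tau> ?N'"
  proof cases
    case 1
    then show ?thesis
      using c_io by (auto simp: defective_def)
  next
    case 2
    \<comment> \<open>Both merged daimons have an output of colour \<open>b\<close>, so neither can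
      witness another colour, not even vacuously.\<close>
    have "\<exists>rs. Daimon rs \<in># L \<and> (\<forall>x \<in> set rs. \<tau> x = Var b')" if "b' \<noteq> b" for b'
    proof -
      obtain rs where rs: "Daimon rs \<in># ?N" "\<forall>x \<in> set rs. \<tau> x = Var b'"
        using 2 by blast
      then have "Daimon rs \<noteq> ?D" "Daimon rs \<noteq> ?E"
        using b \<open>b' \<noteq> b\<close> by auto
      with rs c_io(6) show ?thesis
        by auto
    qed
    note other = this
    then have "0 < daimons L"
      unfolding daimons_pos_iff by blast
    moreover have "\<exists>rs. Daimon rs \<in># ?N' \<and> (\<forall>x \<in> set rs. \<tau> x = Var b')" for b'
    proof (cases "b' = b")
      case True
      then show ?thesis
        using b by (intro exI[of _ "ps @ ps' @ qs @ qs'"]) auto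
    next
      case False
      then show ?thesis
        using other[of b'] by auto
    qed
    ultimately show ?thesis
      by (auto simp: defective_def)
  qed
qed

lemma cut_step_invariant:
  assumes "cut_step N N'" "closed_typed \<tau> (links N)" "defective \<tau> (links N)"
  shows "closed_typed \<tau> (links N') \<and> defective \<tau> (links N') \<and> conclusions N' = conclusions N"
  using assms
proof cases
  case (multiplicative c p q p1 p2 q1 q2 L C)
  then show ?thesis
    using cut_step_multiplicative_invariant[of \<tau> p1 p2 p c q1 q2 q L] assms(2,3) by simp
next
  case (daimon c p q ps ps' qs qs' L C)
  then show ?thesis
    using cut_step_daimon_invariant[of \<tau> ps p ps' c qs q qs' L] assms(2,3) by simp
qed

lemma cut_steps_invariant:
  "cut_step\<^sup>*\<^sup>* N N' \<Longrightarrow> closed_typed \<tau> (links N) \<Longrightarrow> defective \<tau> (links N) \<Longrightarrow>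
   closed_typed \<tau> (links N') \<and> defective \<tau> (links N') \<and> conclusions N' = conclusions N"
  by (induction rule: rtranclp_induct) (auto dest: cut_step_invariant)

text \<open>Each step replaces three links by two or by one.\<close>

lemma normal_form_exists: "\<exists>N'. normal_form_of N N'"
proof (induction "size (links N)" arbitrary: N rule: less_induct)
  case less
  show ?case
  proof (cases "\<exists>M. cut_step N M")
    case True
    then obtain M where M: "cut_step N M"
      by blast
    then have "size (links M) < size (links N)"
      by cases auto
    then obtain N' where "normal_form_of M N'"
      using less by blast
    then show ?thesis
      using M unfolding normal_form_of_def by (meson converse_rtranclp_into_rtranclp)
  qed (auto simp: normal_form_of_def)
qed

text \<open>The ends of the cut have dual labels, so they are produced by a par and a tensor link or
  by daimons. Every such cut can be reduced, except one inside a single daimon.\<close>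

lemma normal_cut_is_cyclic:
  assumes "closed_typed \<tau> (links N)" and normal: "\<And>N'. \<not> cut_step N N'" and cut: "Cut p q \<in># links N"
  shows "has_cyclic_cut N"
proof -
  have produced: "\<exists>l. l \<in># links N \<and> x \<in> set (outputs l) \<and> link_typed \<tau> l" if "x \<in> {p, q}" for x
  proof -
    have "0 < in_deg (links N) x"
      unfolding in_deg_pos_iff using that cut by (intro bexI[of _ "Cut p q"]) auto
    then have "0 < out_deg (links N) x"
      using assms(1) by (simp add: closed_typed_def)
    then show ?thesis
      using assms(1) unfolding out_deg_pos_iff closed_typed_def by blast
  qed
  obtain k where k: "k \<in># links N" "p \<in> set (outputs k)" "link_typed \<tau> k"
    using produced by blast
  obtain l where l: "l \<in># links N" "q \<in> set (outputs l)" "link_typed \<tau> l"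
    using produced by blast
  have "link_typed \<tau> (Cut p q)"
    using assms(1) cut unfolding closed_typed_def by blast
  then have dual_id: "\<tau> q = dual id (\<tau> p)"
    by simp
  have no_mult: False
    if pt: "Par p1 p2 x \<in># links N" "Tensor q1 q2 y \<in># links N" "Cut p q \<in> {Cut x y, Cut y x}"
    for p1 p2 x q1 q2 y
  proof -
    obtain L where "links N = {#Par p1 p2 x, Cut p q, Tensor q1 q2 y#} + L"
      using multi_member_split3[of "Par p1 p2 x" "links N" "Cut p q" "Tensor q1 q2 y"] pt cut by auto
    then have "cut_step N (Net ({#Cut p1 q1, Cut p2 q2#} + L) (conclusions N))"
      using cut_step.multiplicative[OF pt(3), of p1 p2 q1 q2 L "conclusions N"]
      by (metis net.collapse)
    then show False
      using normal by blast
  qed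
  show ?thesis
  proof (cases k)
    case (Daimon ps)
    then obtain qs where qs: "l = Daimon qs"
      using k l dual_id by (cases l) auto
    have "qs = ps"
    proof (rule ccontr)
      assume "qs \<noteq> ps"
      then obtain L where L: "links N = {#Daimon ps, Cut p q, Daimon qs#} + L"
        using multi_member_split3[of "Daimon ps" "links N" "Cut p q" "Daimon qs"] k l cut Daimon qs by auto
      obtain us us' vs vs' where "ps = us @ p # us'" "qs = vs @ q # vs'"
        using k(2) l(2) Daimon qs split_list[of p ps] split_list[of q qs] by auto
      then have "cut_step N (Net ({#Daimon (us @ us' @ vs @ vs')#} + L) (conclusions N))"
        using cut_step.daimon[of "Cut p q" p q us us' vs vs' L "conclusions N"] L
        by (metis insertI1 net.collapse)
      then show False
        using normal by blast
    qed
    then show ?thesis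
      using cut k l Daimon qs unfolding has_cyclic_cut_def by auto
  next
    case (Par p1 p2 x)
    then obtain q1 q2 where "l = Tensor q1 q2 q"
      using k l dual_id by (cases l) auto
    then show ?thesis
      using no_mult[of p1 p2 p q1 q2 q] Par k l by auto
  next
    case (Tensor p1 p2 x)
    then obtain q1 q2 where "l = Par q1 q2 q"
      using k l dual_id by (cases l) auto
    then show ?thesis
      using no_mult[of q1 q2 q p1 p2 p] Tensor k l by auto
  qed (use k in auto)
qed

text \<open>In the absence of cuts, a position with a label of greatest size would have to be
  consumed by a connective, whose output has a larger label. So no position is left, only daimons
  without outputs, and one of them alone is not defective.\<close>

lemma normal_form_of_defective:
  assumes typed: "closed_typed \<tau> (links N)" "defective \<tau> (links N)" "conclusions N = []"
    and normal: "\<And>N'. \<not> cut_step N N'"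
  shows "(\<exists>k \<ge> 2. N = Net (replicate_mset k (Daimon [])) []) \<or> has_cyclic_cut N"
proof (cases "\<exists>p q. Cut p q \<in># links N")
  case True
  then show ?thesis
    using normal_cut_is_cyclic[OF typed(1) normal] by blast
next
  case no_cut: False
  have no_output: "out_deg (links N) p = 0" for p
  proof (rule ccontr)
    assume "out_deg (links N) p \<noteq> 0"
    then obtain l where "l \<in># links N" "p \<in> set (outputs l)"
      using out_deg_pos_iff[of "links N" p] by auto
    let ?P = "\<Union>l \<in> set_mset (links N). set (outputs l)"
    have "p \<in> ?P"
      using \<open>l \<in># links N\<close> \<open>p \<in> set (outputs l)\<close> by blast
    then have "finite ?P" "?P \<noteq> {}"
      by blast+
    then obtain m where m: "m \<in> ?P" "\<And>x. x \<in> ?P \<Longrightarrow> size (\<tau> x) \<le> size (\<tau> m)"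
      using Max_ge[of "(\<lambda>x. size (\<tau> x)) ` ?P"] Max_in[of "(\<lambda>x. size (\<tau> x)) ` ?P"]
      by (smt (verit) finite_imageI imageE image_eqI image_is_empty)
    have "0 < out_deg (links N) m"
      using m(1) unfolding out_deg_pos_iff by blast
    then have "0 < in_deg (links N) m"
      using typed(1) by (simp add: closed_typed_def)
    then obtain k where k: "k \<in># links N" "m \<in> set (inputs k)"
      unfolding in_deg_pos_iff by blast
    have "link_typed \<tau> k"
      using k(1) typed(1) unfolding closed_typed_def by blast
    then obtain x where "x \<in> set (outputs k)" "size (\<tau> m) < size (\<tau> x)"
      using k no_cut by (cases k) auto
    then show False
      using m(2)[of x] k(1) by fastforce
  qed
  have "l = Daimon []" if "l \<in># links N" for l
  proof -
    have "set (outputs l) = {}"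
      using no_output that out_deg_pos_iff[of "links N"] by (metis equals0I less_irrefl)
    then show ?thesis
      using that no_cut by (cases l) auto
  qed
  then have L: "links N = replicate_mset (size (links N)) (Daimon [])"
    by (metis set_mset_subset_singletonD subsetI singleton_iff)
  have "2 \<le> size (links N)"
  proof (rule ccontr)
    assume "\<not> 2 \<le> size (links N)"
    moreover have "size (links N) \<noteq> 0"
      using typed(1) by (simp add: closed_typed_def)
    ultimately have "links N = {#Daimon []#}"
      using L by (metis One_nat_def Suc_1 less_2_cases not_less_eq_eq replicate_mset_0 replicate_mset_Suc not_le)
    then show False
      using typed(2) by (simp add: defective_def)
  qed
  then show ?thesis
    using L typed(3) by (metis net.collapse)
qed

section \<open>Incorrect nets\<close>

lemma conclusions_subset_positions: "represents S \<pi> \<Longrightarrow> set (conclusions S) \<subseteq> positions S"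
  by (induction rule: represents.induct) (auto simp: positions_def simp del: positions_simps)

lemma link_positions: "l \<in># L \<Longrightarrow> set (inputs l) \<union> set (outputs l) \<subseteq> positions (Net L C)"
  by (auto simp: positions_def)

text \<open>A cut rule joins nets with disjoint positions, and every daimon lies within one of
  them.\<close>

lemma represents_no_cyclic_cut: "represents S \<pi> \<Longrightarrow> \<not> has_cyclic_cut S"
proof (induction rule: represents.induct)
  case (cut L C p1 \<pi> M D p2 \<rho> c)
  have "p1 \<in> positions (Net L (C @ [p1]))" "p2 \<in> positions (Net M (D @ [p2]))"
    using conclusions_subset_positions cut.hyps(1,2) by fastforce+
  moreover have "set ps \<subseteq> positions (Net L (C @ [p1]))" if "Daimon ps \<in># L" for ps
    using link_positions[OF that, of "C @ [p1]"] by simp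
  moreover have "set ps \<subseteq> positions (Net M (D @ [p2]))" if "Daimon ps \<in># M" for ps
    using link_positions[OF that, of "D @ [p2]"] by simp
  moreover have "{p, q} \<subseteq> positions (Net L (C @ [p1]))" if "Cut p q \<in># L" for p q
    using link_positions[OF that, of "C @ [p1]"] by simp
  moreover have "{p, q} \<subseteq> positions (Net M (D @ [p2]))" if "Cut p q \<in># M" for p q
    using link_positions[OF that, of "D @ [p2]"] by simp
  ultimately show ?case
    using cut.hyps(3,4) cut.IH unfolding has_cyclic_cut_def by auto blast+
next
  case (tensor L C p1 \<pi> M D p2 \<rho> p)
  have "set ps \<subseteq> positions (Net L (C @ [p1]))" if "Daimon ps \<in># L" for ps
    using link_positions[OF that, of "C @ [p1]"] by simp
  moreover have "set ps \<subseteq> positions (Net M (D @ [p2]))" if "Daimon ps \<in># M" for ps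
    using link_positions[OF that, of "D @ [p2]"] by simp
  moreover have "{p, q} \<subseteq> positions (Net L (C @ [p1]))" if "Cut p q \<in># L" for p q
    using link_positions[OF that, of "C @ [p1]"] by simp
  moreover have "{p, q} \<subseteq> positions (Net M (D @ [p2]))" if "Cut p q \<in># M" for p q
    using link_positions[OF that, of "D @ [p2]"] by simp
  ultimately show ?case
    using tensor.hyps(3) tensor.IH unfolding has_cyclic_cut_def by auto blast+
qed (auto simp: has_cyclic_cut_def)

text \<open>Every rule except the daimon rule leaves behind a connective, a cut or, for an exchange,
  two conclusions.\<close>

lemma represents_daimons:
  "represents S \<pi> \<Longrightarrow> conclusions S = [] \<Longrightarrow> (\<forall>l \<in># links S. l = Daimon []) \<Longrightarrow> size (links S) = 1"
  by (induction rule: represents.induct) auto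

section \<open>Sums of nets\<close>

text \<open>Glues data on two nets along the even and odd renamings of \<open>parallel\<close> and
  \<open>interaction\<close>.\<close>

definition join :: "(nat \<Rightarrow> 'a) \<Rightarrow> (nat \<Rightarrow> 'a) \<Rightarrow> nat \<Rightarrow> 'a" where
  "join f g n = (if even n then f (n div 2) else g (n div 2))"

definition sum_links :: "nat link multiset \<Rightarrow> nat link multiset \<Rightarrow> nat link multiset" where
  "sum_links L M = image_mset (map_link (\<lambda>p. 2 * p)) L + image_mset (map_link (\<lambda>p. 2 * p + 1)) M"

lemma map_link_simps [simp]:
  "inputs (map_link f l) = map f (inputs l)" "outputs (map_link f l) = map f (outputs l)"
  "is_daimon (map_link f l) = is_daimon l" "is_tensor (map_link f l) = is_tensor l"
  "is_cut (map_link f l) = is_cut l"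
  by (cases l; simp)+

lemma wf_link_map_link: "inj f \<Longrightarrow> wf_link l \<Longrightarrow> wf_link (map_link f l)"
  by (auto simp: wf_link_def distinct_map inj_on_def)

lemma link_typed_map_link: "link_typed \<tau> (map_link f l) = link_typed (\<tau> \<circ> f) l"
  by (cases l) auto

lemma join_comp [simp]: "join f g \<circ> (\<lambda>p. 2 * p) = f" "join f g \<circ> (\<lambda>p. Suc (2 * p)) = g"
  by (auto simp: join_def fun_eq_iff)

lemma double_mem: "x \<in> (\<lambda>p. 2 * p) ` A \<longleftrightarrow> even x \<and> x div 2 \<in> A"
  "x \<in> (\<lambda>p. Suc (2 * p)) ` A \<longleftrightarrow> odd x \<and> x div 2 \<in> A" for x :: nat
  by (auto simp: image_iff intro: bexI[of _ "x div 2"])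

lemma deg_sum_links:
  "in_deg (sum_links L M) = join (in_deg L) (in_deg M)"
  "out_deg (sum_links L M) = join (out_deg L) (out_deg M)"
proof -
  have L: "in_deg (image_mset (map_link (\<lambda>p. 2 * p)) L) x = (if even x then in_deg L (x div 2) else 0)"
    "out_deg (image_mset (map_link (\<lambda>p. 2 * p)) L) x = (if even x then out_deg L (x div 2) else 0)" for x
    by (induction L) (auto simp: double_mem)
  have M: "in_deg (image_mset (map_link (\<lambda>p. Suc (2 * p))) M) x = (if even x then 0 else in_deg M (x div 2))"
    "out_deg (image_mset (map_link (\<lambda>p. Suc (2 * p))) M) x = (if even x then 0 else out_deg M (x div 2))" for x
    by (induction M) (auto simp: double_mem)
  show "in_deg (sum_links L M) = join (in_deg L) (in_deg M)"
    "out_deg (sum_links L M) = join (out_deg L) (out_deg M)"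
    by (auto simp: sum_links_def fun_eq_iff join_def L M)
qed

lemma count_sum_links [simp]:
  "daimons (sum_links L M) = daimons L + daimons M"
  "tensors (sum_links L M) = tensors L + tensors M"
  "cuts (sum_links L M) = cuts L + cuts M"
proof -
  have "daimons (image_mset (map_link f) L) = daimons L" "tensors (image_mset (map_link f) L) = tensors L"
    "cuts (image_mset (map_link f) L) = cuts L" for f :: "nat \<Rightarrow> nat" and L
    by (induction L) auto
  then show "daimons (sum_links L M) = daimons L + daimons M"
    "tensors (sum_links L M) = tensors L + tensors M" "cuts (sum_links L M) = cuts L + cuts M"
    by (simp_all add: sum_links_def)
qed

lemma typed_sum_links:
  assumes "\<And>l. l \<in># L \<Longrightarrow> wf_link l \<and> link_typed \<tau> l" "\<And>l. l \<in># M \<Longrightarrow> wf_link l \<and> link_typed \<tau>' l"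
    and "l \<in># sum_links L M"
  shows "wf_link l \<and> link_typed (join \<tau> \<tau>') l"
  using assms by (auto simp: sum_links_def link_typed_map_link intro!: wf_link_map_link injI)

lemma links_parallel: "links (parallel S T) = sum_links (links S) (links T)"
  and conclusions_parallel:
    "conclusions (parallel S T) = map (\<lambda>p. 2 * p) (conclusions S) @ map (\<lambda>p. Suc (2 * p)) (conclusions T)"
  by (simp_all add: parallel_def sum_links_def net.map_sel)

text \<open>One daimon in excess for each conclusion: this surplus is additive over
  \<open>parallel\<close> and is used up by the cuts of an interaction. Asking for
  \<open>wired\<close> rather than \<open>is_net\<close> admits the empty list of tests.\<close>

definition cotyped :: "bool formula list \<Rightarrow> nat net \<Rightarrow> bool" where
  "cotyped Fs T \<longleftrightarrow> wired T \<and> cuts (links T) = 0 \<and>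
     daimons (links T) = tensors (links T) + length Fs \<and>
     (\<exists>\<tau>. (\<forall>l \<in># links T. link_typed \<tau> l) \<and> map \<tau> (conclusions T) = Fs)"

lemma cotyped_parallel:
  assumes "cotyped Fs S" "cotyped Gs T"
  shows "cotyped (Fs @ Gs) (parallel S T)"
proof -
  obtain \<tau> \<tau>' where \<tau>: "\<forall>l \<in># links S. link_typed \<tau> l" "map \<tau> (conclusions S) = Fs"
    and \<tau>': "\<forall>l \<in># links T. link_typed \<tau>' l" "map \<tau>' (conclusions T) = Gs"
    using assms by (auto simp: cotyped_def)
  have S: "wired S" and T: "wired T"
    using assms by (auto simp: cotyped_def)
  have typed: "wf_link l \<and> link_typed (join \<tau> \<tau>') l" if "l \<in># links (parallel S T)" for l
    using typed_sum_links[of "links S" \<tau> "links T" \<tau>' l] \<tau>(1) \<tau>'(1) wired_wf[OF S] wired_wf[OF T] that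
    by (auto simp: links_parallel)
  have "distinct (conclusions (parallel S T))"
    using S T by (auto simp: wired_def conclusions_parallel distinct_map inj_on_def) presburger
  moreover have "in_deg (links (parallel S T)) p \<le> out_deg (links (parallel S T)) p \<and>
      out_deg (links (parallel S T)) p \<le> 1 \<and>
      (p \<in> set (conclusions (parallel S T)) \<longleftrightarrow>
        in_deg (links (parallel S T)) p < out_deg (links (parallel S T)) p)" for p
    using S T by (auto simp: wired_def links_parallel deg_sum_links join_def conclusions_parallel double_mem)
  ultimately have "wired (parallel S T)"
    using typed by (simp add: wired_def)
  moreover have "map (join \<tau> \<tau>') (conclusions (parallel S T)) = Fs @ Gs"
    using \<tau>(2) \<tau>'(2) by (simp add: conclusions_parallel)
  ultimately show ?thesis
    using typed assms unfolding cotyped_def by (auto simp: links_parallel)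
qed

lemma cotyped_parallel_list:
  "list_all2 (\<lambda>T F. cotyped [F] T) Ts Fs \<Longrightarrow> cotyped Fs (parallel_list Ts)"
proof (induction rule: list_all2_induct)
  case Nil
  then show ?case
    by (simp add: parallel_list_def cotyped_def wired_def)
next
  case (Cons T Ts F Fs)
  then show ?case
    using cotyped_parallel[of "[F]" T Fs "parallel_list Ts"] by (simp add: parallel_list_def)
qed

lemma mset_cuts:
  assumes "length cs = length ds" "distinct (cs @ ds)"
  shows "in_deg (mset (map2 Cut cs ds)) p = (if p \<in> set cs \<union> set ds then 1 else 0)"
    and "out_deg (mset (map2 Cut cs ds)) p = 0" and "daimons (mset (map2 Cut cs ds)) = 0"
    and "tensors (mset (map2 Cut cs ds)) = 0" and "cuts (mset (map2 Cut cs ds)) = length cs"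
  using assms by (induction cs ds rule: list_induct2) auto

text \<open>The number of conclusions of \<open>S\<close> is both the surplus of daimons in
  \<open>T\<close> and the number of new cuts, so the count of the interaction is off exactly when
  that of \<open>S\<close> is. The daimons of \<open>S\<close> keep their colours and still witness
  the other defect.\<close>

lemma interaction_typed:
  assumes S: "wired S" "links S \<noteq> {#}" "cuts (links S) = 0" "\<And>l. l \<in># links S \<Longrightarrow> link_typed \<tau> l"
    and T: "cotyped (map (\<lambda>p. dual id (\<tau> p)) (conclusions S)) T"
    and defect: "daimons (links S) \<noteq> tensors (links S) + 1 \<or>
      2 \<le> daimons (links S) \<and> (\<forall>b. \<exists>ps. Daimon ps \<in># links S \<and> (\<forall>p \<in> set ps. \<tau> p = Var b))"
  shows "conclusions (interaction S T) = []"
    and "\<exists>\<tau>. closed_typed \<tau> (links (interaction S T)) \<and> defective \<tau> (links (interaction S T))"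
proof -
  let ?cs = "map (\<lambda>p. 2 * p) (conclusions S)" and ?ds = "map (\<lambda>p. Suc (2 * p)) (conclusions T)"
  obtain \<tau>' where T': "\<And>l. l \<in># links T \<Longrightarrow> link_typed \<tau>' l"
    "map \<tau>' (conclusions T) = map (\<lambda>p. dual id (\<tau> p)) (conclusions S)"
    and TT: "wired T" "cuts (links T) = 0"
      "daimons (links T) = tensors (links T) + length (conclusions S)"
    using T unfolding cotyped_def by auto
  have len: "length (conclusions T) = length (conclusions S)"
    using arg_cong[OF T'(2), of length] by simp
  show "conclusions (interaction S T) = []"
    using len by (simp add: interaction_def net.map_sel)
  have links: "links (interaction S T) = sum_links (links S) (links T) + mset (map2 Cut ?cs ?ds)"
    using len by (simp add: interaction_def sum_links_def net.map_sel Let_def)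
  have dist: "distinct (?cs @ ?ds)"
    using S(1) TT(1) by (auto simp: wired_def distinct_map inj_on_def) presburger
  have len': "length ?cs = length ?ds"
    using len by simp
  note cuts = mset_cuts[OF len' dist]
  have deg: "in_deg (links (interaction S T)) p = out_deg (links (interaction S T)) p \<and>
      out_deg (links (interaction S T)) p \<le> 1" for p
  proof -
    have "in_deg (links S) x \<le> out_deg (links S) x" "out_deg (links S) x \<le> 1"
      "x \<in> set (conclusions S) \<longleftrightarrow> in_deg (links S) x < out_deg (links S) x"
      "in_deg (links T) x \<le> out_deg (links T) x" "out_deg (links T) x \<le> 1"
      "x \<in> set (conclusions T) \<longleftrightarrow> in_deg (links T) x < out_deg (links T) x" for x
      using S(1) TT(1) by (auto simp: wired_def)
    from this[of "p div 2"] show ?thesis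
      unfolding links in_deg_simps out_deg_simps cuts deg_sum_links join_def by (auto simp: double_mem)
  qed
  have "wf_link l \<and> link_typed (join \<tau> \<tau>') l" if l: "l \<in># links (interaction S T)" for l
  proof -
    consider "l \<in># sum_links (links S) (links T)" | "l \<in> set (map2 Cut ?cs ?ds)"
      using l unfolding links union_iff set_mset_mset by blast
    then show ?thesis
    proof cases
      case 1
      then show ?thesis
        using typed_sum_links[of "links S" \<tau> "links T" \<tau>' l] S T' wired_wf[OF TT(1)] wired_wf[OF S(1)] by blast
    next
      case 2
      then obtain i where i: "i < length (conclusions S)" "l = Cut (?cs ! i) (?ds ! i)"
        using len by (auto simp: set_zip)
      then have "\<tau>' (conclusions T ! i) = dual id (\<tau> (conclusions S ! i))"
        using arg_cong[OF T'(2), of "\<lambda>xs. xs ! i"] len by simp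
      then show ?thesis
        using i len by (simp add: wf_link_def join_def) presburger
    qed
  qed
  then have "closed_typed (join \<tau> \<tau>') (links (interaction S T))"
    using deg S(2) by (auto simp: closed_typed_def links sum_links_def)
  moreover have "defective (join \<tau> \<tau>') (links (interaction S T))"
    using defect
  proof
    assume "daimons (links S) \<noteq> tensors (links S) + 1"
    then show ?thesis
      unfolding defective_def links daimons_simps tensors_simps cuts_simps count_sum_links cuts
      using S(3) TT by simp
  next
    assume two: "2 \<le> daimons (links S) \<and> (\<forall>b. \<exists>ps. Daimon ps \<in># links S \<and> (\<forall>p \<in> set ps. \<tau> p = Var b))"
    have "\<exists>ps. Daimon ps \<in># links (interaction S T) \<and> (\<forall>p \<in> set ps. join \<tau> \<tau>' p = Var b)" for b
    proof -
      obtain ps where "Daimon ps \<in># links S" "\<forall>p \<in> set ps. \<tau> p = Var b"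
        using two by blast
      then show ?thesis
        by (intro exI[of _ "map (\<lambda>p. 2 * p) ps"])
          (auto simp: links sum_links_def join_def intro!: image_eqI[of _ _ "Daimon ps"])
    qed
    then show ?thesis
      using two by (simp add: defective_def links)
  qed
  ultimately show "\<exists>\<tau>. closed_typed \<tau> (links (interaction S T)) \<and> defective \<tau> (links (interaction S T))"
    by blast
qed

section \<open>The tests chosen by a colouring\<close>

definition premise :: "'p net \<Rightarrow> bool \<Rightarrow> 'p \<Rightarrow> 'p" where
  "premise S b p = (THE x. \<exists>p1 p2. (Par p1 p2 p \<in># links S \<or> Tensor p1 p2 p \<in># links S) \<and>
     x = (if b then p2 else p1))"

primrec above :: "'p net \<Rightarrow> 'p \<Rightarrow> bool list \<Rightarrow> 'p" where
  "above S q [] = q"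
| "above S q (b # a) = premise S b (above S q a)"

text \<open>Colours belong to positions, and occurrences of one variable may be coloured
  differently. Hence \<open>premise\<close> walks up the net alongside the formula, to find the
  position of each atom.\<close>

primrec recolour :: "'p net \<Rightarrow> ('p \<Rightarrow> bool) \<Rightarrow> 'x formula \<Rightarrow> 'p \<Rightarrow> bool formula" where
  "recolour S c (Var X) p = Var (c p)"
| "recolour S c (FPar A B) p = FPar (recolour S c A (premise S False p)) (recolour S c B (premise S True p))"
| "recolour S c (FTensor A B) p = FTensor (recolour S c A (premise S False p)) (recolour S c B (premise S True p))"

lemma shape_recolour: "map_formula (\<lambda>_. ()) (recolour S c A p) = map_formula (\<lambda>_. ()) A"
  by (induction A arbitrary: p) auto

lemma addresses_recolour [simp]:
  "par_addresses (recolour S c A p) = par_addresses A"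
  "tensor_addresses (recolour S c A p) = tensor_addresses A"
  "leaf_addresses (recolour S c A p) = leaf_addresses A"
  by (metis addresses_map shape_recolour)+

locale coloured_net =
  fixes S :: "'p net" and \<tau> :: "'p \<Rightarrow> 'x formula" and c :: "'p \<Rightarrow> bool"
  assumes wired: "wired S" and no_cut: "cut_free S"
    and labelling: "formula_labelling S \<tau>" and atomic: "atomic_labelling S \<tau>"
    and coloured: "\<And>l. l \<in># links S \<Longrightarrow> link_coloured c l"
begin

abbreviation col :: "'p \<Rightarrow> bool formula" where
  "col p \<equiv> recolour S c (\<tau> p) p"

lemma premise_eq:
  assumes "Par p1 p2 p \<in># links S \<or> Tensor p1 p2 p \<in># links S"
  shows "premise S b p = (if b then p2 else p1)"
proof -
  have "q1 = p1 \<and> q2 = p2" if "Par q1 q2 p \<in># links S \<or> Tensor q1 q2 p \<in># links S" for q1 q2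
    using that assms wired_same_output[OF wired, of _ _ p] by fastforce
  then show ?thesis
    unfolding premise_def using assms by (intro the_equality) blast+
qed

lemma labels:
  "Par p1 p2 p \<in># links S \<Longrightarrow> \<tau> p = FPar (\<tau> p1) (\<tau> p2)"
  "Tensor p1 p2 p \<in># links S \<Longrightarrow> \<tau> p = FTensor (\<tau> p1) (\<tau> p2)"
  "Daimon ps \<in># links S \<Longrightarrow> p \<in> set ps \<Longrightarrow> \<exists>X. \<tau> p = Var X"
  using labelling atomic by (auto simp: formula_labelling_def atomic_labelling_def initial_positions_def)

lemma link_typed_col:
  assumes "l \<in># links S"
  shows "link_typed col l"
proof (cases l)
  case (Daimon ps)
  then obtain b where "\<forall>p \<in> set ps. c p = b"
    using coloured[OF assms] by auto
  then have "\<forall>p \<in> set ps. col p = Var b"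
    using labels(3) assms Daimon by fastforce
  then show ?thesis
    using Daimon by auto
next
  case (Par p1 p2 p)
  then show ?thesis
    using assms labels(1)[of p1 p2 p] premise_eq[of p1 p2 p] by simp
next
  case (Tensor p1 p2 p)
  then show ?thesis
    using assms labels(2)[of p1 p2 p] premise_eq[of p1 p2 p] by simp
qed (use assms no_cut in \<open>auto simp: cut_free_def\<close>)

lemma producer_cases:
  assumes "0 < out_deg (links S) p"
  obtains p1 p2 where "Par p1 p2 p \<in># links S" | p1 p2 where "Tensor p1 p2 p \<in># links S"
    | X where "\<tau> p = Var X"
proof -
  obtain l where l: "l \<in># links S" "p \<in> set (outputs l)"
    using assms unfolding out_deg_pos_iff by blast
  then show thesis
    using that by (cases l) (auto dest: labels(3))
qed

lemma out_deg_premise: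
  assumes "Par p1 p2 p \<in># links S \<or> Tensor p1 p2 p \<in># links S" "x \<in> {p1, p2}"
  shows "0 < out_deg (links S) x"
proof -
  have "x \<in> set (inputs (Par p1 p2 p))" "x \<in> set (inputs (Tensor p1 p2 p))"
    using assms(2) by auto
  then obtain l where l: "l \<in># links S" "x \<in> set (inputs l)"
    using assms(1) by blast
  obtain k where "k \<in># links S" "x \<in> set (outputs k)"
    by (rule wired_producer[OF wired l])
  then show ?thesis
    unfolding out_deg_pos_iff by blast
qed

text \<open>Atomic labels make the syntax tree end exactly at the daimons, so the addresses in the
  formula \<open>\<tau> q\<close> are also addresses in the net above \<open>q\<close>.\<close>

lemma above_correct:
  assumes q: "0 < out_deg (links S) q"
  shows "subformula_at (\<tau> q) a = Some B \<Longrightarrow>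
    0 < out_deg (links S) (above S q a) \<and> \<tau> (above S q a) = B \<and>
    subformula_at (col q) a = Some (col (above S q a))"
proof (induction a arbitrary: B)
  case Nil
  then show ?case
    using q by simp
next
  case (Cons b a)
  let ?p = "above S q a"
  obtain C where C: "subformula_at (\<tau> q) a = Some C"
    using Cons.prems by (auto split: option.splits)
  note IH = Cons.IH[OF C]
  have "\<nexists>X. \<tau> ?p = Var X"
    using Cons.prems C IH by auto
  then obtain p1 p2 where p: "Par p1 p2 ?p \<in># links S \<or> Tensor p1 p2 ?p \<in># links S"
    using IH by (metis producer_cases)
  have "above S q (b # a) = (if b then p2 else p1)"
    using premise_eq[OF p] by simp
  moreover have "0 < out_deg (links S) (if b then p2 else p1)"
    using out_deg_premise[OF p] by simp
  moreover have "B = \<tau> (if b then p2 else p1)"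
    using p Cons.prems C IH labels(1,2)[of p1 p2 ?p] by auto
  moreover have "subformula_at (col q) (b # a) = Some (col (if b then p2 else p1))"
    using p IH link_typed_col by fastforce
  ultimately show ?case
    by simp
qed

text \<open>The Boolean at the head is the direction of the disconnected premise: the right one
  (\<open>True\<close>) if the left premise has the colour of the conclusion, the left one
  otherwise. By \<open>link_coloured\<close>, the premise that is kept always has that
  colour.\<close>

definition cut_off :: "'p \<Rightarrow> bool list set" where
  "cut_off q = (\<lambda>a. (c (above S q (False # a)) = c (above S q a)) # a) ` par_addresses (\<tau> q)"

text \<open>Colours can change only along disconnected edges, so each block of the test has a single
  colour.\<close>

lemma colour_root:
  assumes q: "0 < out_deg (links S) q"
  shows "subformula_at (\<tau> q) a \<noteq> None \<Longrightarrow> c (above S q (root (cut_off q) a)) = c (above S q a)"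
proof (induction a)
  case (Cons b a)
  let ?p = "above S q a"
  show ?case
  proof (cases "b # a \<in> cut_off q")
    case False
    obtain C where C: "subformula_at (\<tau> q) a = Some C"
      using Cons.prems by (auto split: option.splits)
    note p = above_correct[OF q C]
    have "c (above S q (b # a)) = c ?p"
    proof (cases rule: producer_cases[OF conjunct1[OF p]])
      case (1 p1 p2)
      then have "a \<in> par_addresses (\<tau> q)"
        using p C labels(1) by (fastforce simp: par_addresses_def)
      then have "b \<noteq> (c (above S q (False # a)) = c ?p)"
        using False by (auto simp: cut_off_def)
      then show ?thesis
        using coloured[OF 1] premise_eq[OF disjI1[OF 1]] by (cases b) auto
    next
      case (2 p1 p2)
      then show ?thesis
        using coloured[OF 2] premise_eq[OF disjI2[OF 2]] by auto
    next
      case (3 X)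
      then show ?thesis
        using Cons.prems C p by auto
    qed
    then show ?thesis
      using Cons.IH C False by simp
  qed simp
qed simp

definition test :: "('x \<Rightarrow> 'x) \<Rightarrow> 'p \<Rightarrow> nat net" where
  "test perp q = formula_net (dual perp (\<tau> q)) (cut_off q)"

lemma test_in_tests: "test perp q \<in> tests perp (\<tau> q)"
  unfolding test_def by (rule formula_net_in_tests) (simp add: cut_off_def)

text \<open>Each par of \<open>\<tau> q\<close> contributes a tensor link to the test and
  disconnects one premise, which adds a block; the block of the root is the daimon in excess. The
  daimons are typable because blocks have a single colour.\<close>

lemma cotyped_test:
  assumes q: "0 < out_deg (links S) q"
  shows "cotyped [dual id (col q)] (test perp q)"
proof -
  let ?K = "cut_off q" and ?F = "dual id (col q)"
  let ?\<sigma> = "\<lambda>p. the (subformula_at ?F (from_nat p))"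
  have fin: "finite ?K"
    by (simp add: cut_off_def)
  \<comment> \<open>Nets of formulas depend on addresses only, so the test, built from
    \<open>perp\<close> and the variables, can be relabelled over the colours.\<close>
  have test: "test perp q = formula_net ?F ?K"
    unfolding test_def by (rule formula_net_cong) simp_all
  have "card ?K = card (par_addresses (\<tau> q))"
    unfolding cut_off_def by (rule card_image) (simp add: inj_on_def)
  moreover have "[] \<notin> ?K"
    by (auto simp: cut_off_def)
  ultimately have card: "card (insert [] ?K) = card (par_addresses (\<tau> q)) + 1"
    using fin by simp
  have "\<exists>b. \<forall>p \<in> set (block ?F ?K r). ?\<sigma> p = Var b" for r
  proof (intro exI ballI)
    fix p assume "p \<in> set (block ?F ?K r)"
    then obtain a where a: "a \<in> leaf_addresses (\<tau> q)" "root ?K a = r" "p = to_nat a"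
      by auto
    then obtain X where X: "subformula_at (\<tau> q) a = Some (Var X)"
      by (auto simp: leaf_addresses_def)
    have "subformula_at (col q) a = Some (Var (c (above S q a)))"
      using above_correct[OF q X] by auto
    moreover have "c (above S q a) = c (above S q r)"
      using colour_root[OF q, of a] X a(2) by simp
    ultimately show "?\<sigma> p = Var (c (above S q r))"
      by (simp add: a(3) subformula_at_dual)
  qed
  then have "link_typed ?\<sigma> l" if "l \<in># links (formula_net ?F ?K)" for l
    using that formula_labelling_formula_net[OF fin, of ?F]
    by (cases l) (auto simp: in_formula_net[OF fin] formula_labelling_def simp del: set_block)
  moreover have "wired (formula_net ?F ?K)"
    using is_net_formula_net[OF fin] is_net_iff by blast
  ultimately show ?thesis
    unfolding cotyped_def test by (intro conjI exI[of _ ?\<sigma>]) (simp_all add: count_formula_net[OF fin] card)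
qed

end

theorem corollary79:
  fixes perp :: "'x :: countable \<Rightarrow> 'x"
    and S :: "nat net"
    and As :: "'x formula list"
  assumes "\<And>X. perp (perp X) = X"
    and "is_net S" and "cut_free S"
    and "atomically_testable S As"
    and "\<not> correct perp S"
  shows "\<exists>Ts. length Ts = length As \<and>
           (\<forall>i < length As. Ts ! i \<in> tests perp (As ! i)) \<and>
           (\<exists>S0. normal_form_of (interaction S (parallel_list Ts)) S0) \<and>
           (\<forall>S0. normal_form_of (interaction S (parallel_list Ts)) S0 \<longrightarrow>
              \<not> correct perp S0 \<and>
              ((\<exists>k \<ge> 2. S0 = Net (replicate_mset k (Daimon [])) []) \<or> has_cyclic_cut S0))"
proof -
  obtain \<tau> where \<tau>: "formula_labelling S \<tau>" "atomic_labelling S \<tau>" "map \<tau> (conclusions S) = As"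
    using assms(4) unfolding atomically_testable_def by blast
  have S: "wired S" "links S \<noteq> {#}"
    using assms(2) by (auto simp: is_net_iff)
  have "\<not> seq \<tau> S"
    using assms(5) seq_represents[of \<tau> S perp] unfolding correct_def by blast
  then have bad: "daimons (links S) \<noteq> tensors (links S) + 1 \<or> (\<exists>c. disconnecting c (links S))"
    using seq_or_disconnecting[OF S assms(3) \<tau>(1)] by blast
  \<comment> \<open>If only the count is wrong, any colouring that all links respect yields suitable
    tests, for instance a constant one.\<close>
  have const_coloured: "link_coloured (\<lambda>_. False) l" for l :: "nat link"
    by (cases l) auto
  obtain c where c: "\<And>l. l \<in># links S \<Longrightarrow> link_coloured c l"
    and defect: "daimons (links S) \<noteq> tensors (links S) + 1 \<or> disconnecting c (links S)"
    using bad const_coloured unfolding disconnecting_def by blast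
  interpret coloured_net S \<tau> c
    using S(1) assms(3) \<tau>(1,2) c by unfold_locales
  \<comment> \<open>All tests are read off the same colouring of \<open>S\<close>, so each is typed
    dually to its conclusion.\<close>
  define Ts where "Ts = map (test perp) (conclusions S)"
  let ?I = "interaction S (parallel_list Ts)"
  have pos: "0 < out_deg (links S) q" if "q \<in> set (conclusions S)" for q
    using that S(1) by (auto simp: wired_def)
  have "list_all2 (\<lambda>T F. cotyped [F] T) Ts (map (\<lambda>p. dual id (col p)) (conclusions S))"
    using cotyped_test[OF pos] by (auto simp: Ts_def list_all2_conv_all_nth)
  then have T: "cotyped (map (\<lambda>p. dual id (col p)) (conclusions S)) (parallel_list Ts)"
    by (rule cotyped_parallel_list)
  have "\<exists>ps. Daimon ps \<in># links S \<and> (\<forall>p \<in> set ps. col p = Var b)"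
    if disc: "disconnecting c (links S)" for b
  proof -
    obtain ps where "Daimon ps \<in># links S" "\<forall>p \<in> set ps. c p = b"
      using disc unfolding disconnecting_def by blast
    then show ?thesis
      using labels(3) by (intro exI[of _ ps]) fastforce
  qed
  then have defect': "daimons (links S) \<noteq> tensors (links S) + 1 \<or>
      2 \<le> daimons (links S) \<and> (\<forall>b. \<exists>ps. Daimon ps \<in># links S \<and> (\<forall>p \<in> set ps. col p = Var b))"
    using defect unfolding disconnecting_def by blast
  have "cuts (links S) = 0"
  proof -
    have "\<not> is_cut l" if "l \<in># links S" for l
      using that assms(3) by (cases l) (auto simp: cut_free_def)
    then show ?thesis
      by (auto simp: cuts_def filter_mset_eq_conv)
  qed
  note I = interaction_typed[OF S this link_typed_col T defect']
  obtain \<sigma> where \<sigma>: "closed_typed \<sigma> (links ?I)" "defective \<sigma> (links ?I)"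
    using I(2) by blast
  have "\<not> correct perp S0 \<and> ((\<exists>k \<ge> 2. S0 = Net (replicate_mset k (Daimon [])) []) \<or> has_cyclic_cut S0)"
    if nf: "normal_form_of ?I S0" for S0
  proof -
    have inv: "closed_typed \<sigma> (links S0)" "defective \<sigma> (links S0)" "conclusions S0 = []"
      using cut_steps_invariant[of ?I S0 \<sigma>] nf \<sigma> I(1) unfolding normal_form_of_def by auto
    have shape: "(\<exists>k \<ge> 2. S0 = Net (replicate_mset k (Daimon [])) []) \<or> has_cyclic_cut S0"
      using normal_form_of_defective[OF inv] nf unfolding normal_form_of_def by blast
    moreover have "\<not> represents S0 \<pi>" for \<pi> :: "'x mll_proof"
      using shape represents_no_cyclic_cut[of S0 \<pi>] represents_daimons[of S0 \<pi>] by auto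
    ultimately show ?thesis
      unfolding correct_def by blast
  qed
  moreover have "\<forall>i < length As. Ts ! i \<in> tests perp (As ! i)"
    using test_in_tests \<tau>(3) by (auto simp: Ts_def)
  moreover have "length Ts = length As"
    using \<tau>(3) by (auto simp: Ts_def)
  ultimately show ?thesis
    using normal_form_exists[of ?I] by blast
qed

end
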